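(* There exists a polynomial-time algorithm which, given a graph $G$ and an integer $k$ with $2\le k\le |V(G)|$, constructs a spanning $k$-partite subgraph $H$ of $G$ such that $\lambda(H)\ge \left\lceil \frac{k-1}{k}\lambda(G)\right\rceil$.
   Context: Graphs are finite, undirected, without loops or multiple edges. A subgraph $H$ of $G$ is spanning if $V(H)=V(G)$. A graph is $k$-partite if its vertex set can be partitioned into $k$ independent sets (some of which may be empty). The edge-connectivity $\lambda(G)$ of a graph on at least two vertices is the minimum, over non-empty proper subsets $X\subset V(G)$, of the number of edges with exactly one end-vertex in $X$. *)

theory Defs
  imports Complex_Main "HOL-Computational_Algebra.Polynomial" "HOL-Library.Disjoint_Sets"
begin

section \<open>Graphs\<close>

record 'a graph =
  verts :: "'a set"
  edges :: "'a set set"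

definition is_graph :: "'a graph \<Rightarrow> bool" where
  "is_graph G \<longleftrightarrow> finite (verts G) \<and> (\<forall>e\<in>edges G. e \<subseteq> verts G \<and> card e = 2)"

definition subgraph :: "'a graph \<Rightarrow> 'a graph \<Rightarrow> bool" where
  "subgraph H G \<longleftrightarrow> is_graph H \<and> verts H \<subseteq> verts G \<and> edges H \<subseteq> edges G"

definition spanning_subgraph :: "'a graph \<Rightarrow> 'a graph \<Rightarrow> bool" where
  "spanning_subgraph H G \<longleftrightarrow> subgraph H G \<and> verts H = verts G"

definition independent :: "'a graph \<Rightarrow> 'a set \<Rightarrow> bool" where
  "independent G A \<longleftrightarrow> A \<subseteq> verts G \<and> (\<forall>e\<in>edges G. \<not> e \<subseteq> A)"

text \<open>The classes are indexed, so that several of them may be empty.\<close>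

definition k_partite :: "nat \<Rightarrow> 'a graph \<Rightarrow> bool" where
  "k_partite k G \<longleftrightarrow>
     (\<exists>A :: nat \<Rightarrow> 'a set. disjoint_family_on A {..<k} \<and> (\<Union>i<k. A i) = verts G \<and>
        (\<forall>i<k. independent G (A i)))"

definition cut_edges :: "'a graph \<Rightarrow> 'a set \<Rightarrow> 'a set set" where
  "cut_edges G X = {e \<in> edges G. card (e \<inter> X) = 1}"

text \<open>Meaningful only for graphs with at least two vertices, since otherwise the
  minimum is over the empty set.\<close>

definition edge_connectivity :: "'a graph \<Rightarrow> nat" where
  "edge_connectivity G = Min {card (cut_edges G X) | X. X \<noteq> {} \<and> X \<subset> verts G}"


section \<open>Algorithms\<close>

text \<open>Algorithms are programs of a deterministic random access machine with structured control flow.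
  The store consists of arrays of natural numbers, addressed by name and index; a scalar
  variable \<open>x\<close> is the cell \<open>x[0]\<close>. A program mentions only finitely many array names, so
  the arrays can be interleaved in a single linear memory.

  Every elementary operation costs one time unit. The only arithmetic
  operations are addition and truncated subtraction: in \<open>t\<close> time units the bit length of the
  stored numbers grows by at most \<open>O(t)\<close>, hence polynomial time on this machine
  coincides with polynomial time on Turing machines. (Unit-cost multiplication would
  destroy this property.)\<close>

type_synonym state = "string \<Rightarrow> nat \<Rightarrow> nat"

datatype expr =
    Lit nat
  | Get string expr
  | Add expr expr
  | Sub expr expr

datatype prog =
    Skip
  | Put string expr expr
  | Seq prog prog
  | If expr prog prog
  | While expr prog

fun val :: "expr \<Rightarrow> state \<Rightarrow> nat" where
  "val (Lit m) s = m"
| "val (Get x e) s = s x (val e s)"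
| "val (Add a b) s = val a s + val b s"
| "val (Sub a b) s = val a s - val b s"

fun ops :: "expr \<Rightarrow> nat" where
  "ops (Lit m) = 1"
| "ops (Get x e) = 1 + ops e"
| "ops (Add a b) = 1 + ops a + ops b"
| "ops (Sub a b) = 1 + ops a + ops b"

text \<open>\<open>exec c s t s'\<close>: started in state \<open>s\<close>, program \<open>c\<close> halts in state \<open>s'\<close> after \<open>t\<close> time
  units. Nonzero values count as true.\<close>

inductive exec :: "prog \<Rightarrow> state \<Rightarrow> nat \<Rightarrow> state \<Rightarrow> bool" where
  Skip: "exec Skip s 1 s"
| Put: "exec (Put x i e) s (1 + ops i + ops e) (s(x := (s x)(val i s := val e s)))"
| Seq: "exec c s t s' \<Longrightarrow> exec d s' t' s'' \<Longrightarrow> exec (Seq c d) s (t + t') s''"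
| IfTrue: "val b s \<noteq> 0 \<Longrightarrow> exec c s t s' \<Longrightarrow> exec (If b c d) s (1 + ops b + t) s'"
| IfFalse: "val b s = 0 \<Longrightarrow> exec d s t s' \<Longrightarrow> exec (If b c d) s (1 + ops b + t) s'"
| WhileFalse: "val b s = 0 \<Longrightarrow> exec (While b c) s (1 + ops b) s"
| WhileTrue: "val b s \<noteq> 0 \<Longrightarrow> exec c s t s' \<Longrightarrow> exec (While b c) s' t' s'' \<Longrightarrow>
    exec (While b c) s (1 + ops b + t + t') s''"

lemma exec_deterministic:
  "exec c s t s' \<Longrightarrow> exec c s u s'' \<Longrightarrow> u = t \<and> s'' = s'"
proof (induction arbitrary: u s'' rule: exec.induct)
  case Skip
  then show ?case by (auto elim: exec.cases)
next
  case Put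
  then show ?case by (auto elim: exec.cases)
next
  case (Seq c s t s' d t' s'')
  from Seq.prems show ?case
    by (cases rule: exec.cases) (use Seq.IH in blast)+
next
  case (IfTrue b s c t s' d)
  from IfTrue.prems show ?case
    by (cases rule: exec.cases) (use IfTrue in blast)+
next
  case (IfFalse b s d t s' c)
  from IfFalse.prems show ?case
    by (cases rule: exec.cases) (use IfFalse in blast)+
next
  case (WhileFalse b s c)
  from WhileFalse.prems show ?case
    by (cases rule: exec.cases) (use WhileFalse in simp_all)
next
  case (WhileTrue b s c t s' t' s'')
  from WhileTrue.prems show ?case
    by (cases rule: exec.cases) (use WhileTrue in blast)+
qed


section \<open>Input and output of graph algorithms\<close>

text \<open>Graphs handed to an algorithm have vertex set \<open>{0..<n}\<close> and are given by their
  adjacency matrices, stored row by row: the cell \<open>i * n + j\<close> is the entry for \<open>i, j < n\<close>.\<close>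

definition adj_matrix :: "nat \<Rightarrow> nat graph \<Rightarrow> nat \<Rightarrow> nat" where
  "adj_matrix n G a = (if a < n * n \<and> {a div n, a mod n} \<in> edges G then 1 else 0)"

definition input_state :: "nat \<Rightarrow> nat \<Rightarrow> nat graph \<Rightarrow> state" where
  "input_state n k G = (\<lambda>x a. 0)
     (''n'' := (\<lambda>a. 0)(0 := n),
      ''k'' := (\<lambda>a. 0)(0 := k),
      ''G'' := adj_matrix n G)"

definition output_graph :: "nat \<Rightarrow> state \<Rightarrow> nat graph \<Rightarrow> bool" where
  "output_graph n s H \<longleftrightarrow>
     verts H = {..<n} \<and> (\<forall>a<n * n. s ''H'' a = adj_matrix n H a)"

end

theory Submission imports Defs begin

text \<open>Start from any colouring with \<open>k\<close> colours and let \<open>H\<close> consist of the bichromatic edges. If the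
  colours on a set \<open>X\<close> are shifted cyclically by \<open>0, \<dots>, k - 1\<close> in turn, every edge leaving \<open>X\<close> is
  monochromatic exactly once; so if no shift decreases the number of monochromatic edges, then at
  most \<open>1/k\<close> of the edges of \<open>G\<close> leaving \<open>X\<close> are missing in \<open>H\<close>. It suffices to have this for one
  minimum cut \<open>X\<close> of \<open>H\<close>, and the algorithm of Stoer and Wagner yields at most \<open>n\<close> candidates for it:
  in each of its phases the vertices are listed in maximum adjacency order, the last one gives a
  minimum cut separating it from the last but one, and these two are merged. Each shift that
  succeeds decreases the number of monochromatic edges, so quadratically many rounds suffice.\<close>

section \<open>Cuts\<close>

text \<open>Local optimality cannot be tested for all sets, of which there are exponentially many,
  and \<open>H\<close> changes while its minimum cut is being sought: a shift that succeeds in the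
  middle of a round makes the classes found so far describe an older graph. Nothing is therefore
  claimed about cuts in such a round, only that the monochromatic count has dropped. In a round
  without success the colouring is constant, and no minimum cut has to be singled out: a set
  separating two vertices starts as a union of classes and must stop being one before a single class
  remains. It stops in a phase whose merged vertices it separates, and there its cut is at least the
  cut of the phase, for which the shifts have been tested.\<close>

definition cut :: "('a \<Rightarrow> 'a \<Rightarrow> nat) \<Rightarrow> 'a set \<Rightarrow> 'a set \<Rightarrow> nat" where
  "cut w B C = (\<Sum>a\<in>B \<inter> C. \<Sum>b\<in>B - C. w a b)"

text \<open>The second set of a cut need not lie in the vertex set, because later it is given by
  conditions such as \<open>{u. r u = t}\<close>. Only its trace matters.\<close>

lemma cut_cong: "V \<inter> C = V \<inter> D \<Longrightarrow> cut w V C = cut w V D"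
proof -
  assume "V \<inter> C = V \<inter> D"
  moreover from this have "V - C = V - D" by blast
  ultimately show ?thesis by (simp add: cut_def)
qed

lemma cut_insert:
  assumes "finite B" "u \<notin> B" "\<And>x y. w x y = w y x"
  shows "cut w (insert u B) C = cut w B C + sum (w u) (if u \<in> C then B - C else B \<inter> C)"
proof (cases "u \<in> C")
  case True
  then have "insert u B \<inter> C = insert u (B \<inter> C)" "insert u B - C = B - C" by auto
  with True assms show ?thesis by (simp add: cut_def)
next
  case False
  then have *: "insert u B \<inter> C = B \<inter> C" "insert u B - C = insert u (B - C)" by auto
  have "sum (w u) (B \<inter> C) = (\<Sum>a\<in>B \<inter> C. w a u)" by (intro sum.cong refl assms(3))
  with False assms(1,2) show ?thesis by (simp add: cut_def * sum.distrib)
qed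

text \<open>The invariant of a maximum adjacency order with prefix \<open>A\<close> and last vertex \<open>t\<close>. Quantifying over all
  \<open>u\<close> outside \<open>A\<close>, not only the next vertex, makes it inductive.\<close>

definition adjacency_bound :: "('a \<Rightarrow> 'a \<Rightarrow> nat) \<Rightarrow> 'a set \<Rightarrow> 'a set \<Rightarrow> 'a \<Rightarrow> bool" where
  "adjacency_bound w S A t \<longleftrightarrow>
     (\<forall>C. \<forall>u\<in>S - A. (u \<in> C) \<noteq> (t \<in> C) \<longrightarrow> sum (w u) A \<le> cut w (insert u A) C)"

lemma adjacency_bound_singleton:
  assumes "\<And>x y. w x y = w y x"
  shows "adjacency_bound w S {t} t"
  unfolding adjacency_bound_def
proof (intro allI ballI impI)
  fix C u assume "u \<in> S - {t}" "(u \<in> C) \<noteq> (t \<in> C)"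
  moreover from this have "(if u \<in> C then {t} - C else {t} \<inter> C) = {t}" by auto
  ultimately show "sum (w u) {t} \<le> cut w {u, t} C"
    using cut_insert[of "{t}" u w C] assms by auto
qed

text \<open>The pair \<open>u\<close>, \<open>x\<close> is separated, so \<open>w u x\<close> occurs
  on both sides and only the contribution of \<open>A\<close> has to be bounded. If \<open>x\<close>
  lies on the side of \<open>t\<close>, the old bound for \<open>u\<close> does this; otherwise the
  old bound for \<open>x\<close> does, since \<open>x\<close> has the largest weight to
  \<open>A\<close>.\<close>

lemma adjacency_bound_insert:
  assumes "finite A" "x \<in> S - A" and sym: "\<And>x y. w x y = w y x"
    and bound: "adjacency_bound w S A t"
    and max: "\<And>u. u \<in> S - A \<Longrightarrow> sum (w u) A \<le> sum (w x) A"
  shows "adjacency_bound w S (insert x A) x"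
  unfolding adjacency_bound_def
proof (intro allI ballI impI)
  fix C u assume u: "u \<in> S - insert x A" and sep: "(u \<in> C) \<noteq> (x \<in> C)"
  define opp where "opp B = (if u \<in> C then B - C else B \<inter> C)" for B
  have "opp (insert x A) = insert x (opp A)" "x \<notin> opp A" "finite (opp A)"
    using sep assms(1,2) by (auto simp: opp_def)
  then have opp: "sum (w u) (opp (insert x A)) = w u x + sum (w u) (opp A)" by simp
  have lhs: "sum (w u) (insert x A) = w u x + sum (w u) A" using assms(1,2) by simp
  have rhs: "cut w (insert u (insert x A)) C = cut w (insert x A) C + sum (w u) (opp (insert x A))"
    unfolding opp_def by (rule cut_insert) (use u assms(1) sym in auto)
  have mono: "cut w A C \<le> cut w (insert x A) C"
    using cut_insert[of A x w C] assms(1,2) sym by simp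
  show "sum (w u) (insert x A) \<le> cut w (insert u (insert x A)) C"
  proof (cases "(x \<in> C) = (t \<in> C)")
    case True
    then have "sum (w u) A \<le> cut w (insert u A) C"
      using bound u sep by (auto simp: adjacency_bound_def)
    also have "\<dots> = cut w A C + sum (w u) (opp A)"
      unfolding opp_def by (rule cut_insert) (use u assms(1) sym in auto)
    finally show ?thesis using lhs rhs opp mono by simp
  next
    case False
    then have "sum (w x) A \<le> cut w (insert x A) C"
      using bound assms(2) by (auto simp: adjacency_bound_def)
    then show ?thesis using lhs rhs opp max[of u] u by simp
  qed
qed

lemma cut_singleton:
  assumes "t \<in> S"
  shows "cut w S {t} = sum (w t) (S - {t})"
proof -
  have "S \<inter> {t} = {t}" using assms by auto
  then show ?thesis by (simp add: cut_def)
qed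

text \<open>Edge weights after contracting each fibre of \<open>r\<close> to a vertex. The diagonal
  comes from pairs inside a fibre and never enters a cut.\<close>

definition class_weight :: "('a \<Rightarrow> 'b) \<Rightarrow> 'a set \<Rightarrow> ('a \<Rightarrow> 'a \<Rightarrow> nat) \<Rightarrow> 'b \<Rightarrow> 'b \<Rightarrow> nat" where
  "class_weight r V h x y = (\<Sum>u\<in>{u\<in>V. r u = x}. \<Sum>v\<in>{v\<in>V. r v = y}. h u v)"

lemma class_weight_commute:
  assumes "\<And>u v. h u v = h v u"
  shows "class_weight r V h x y = class_weight r V h y x"
  unfolding class_weight_def by (subst sum.swap) (simp only: assms)

lemma sum_fibres:
  assumes "finite V" "finite A"
  shows "(\<Sum>a\<in>A. \<Sum>v\<in>{v\<in>V. r v = a}. f v) = (\<Sum>v\<in>{v\<in>V. r v \<in> A}. f v)"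
proof -
  have "{v \<in> {v\<in>V. r v \<in> A}. r v = a} = {v\<in>V. r v = a}" if "a \<in> A" for a
    using that by auto
  then have "(\<Sum>a\<in>A. \<Sum>v\<in>{v\<in>V. r v = a}. f v)
      = (\<Sum>a\<in>A. sum f {v \<in> {v\<in>V. r v \<in> A}. r v = a})"
    by (intro sum.cong) auto
  also have "\<dots> = (\<Sum>v\<in>{v\<in>V. r v \<in> A}. f v)"
    by (rule sum.group) (use assms in auto)
  finally show ?thesis .
qed

lemma sum_class_weight:
  assumes "finite V" "finite A"
  shows "sum (class_weight r V h x) A
    = (\<Sum>u\<in>{u\<in>V. r u = x}. \<Sum>v\<in>{v\<in>V. r v \<in> A}. h u v)"
  unfolding class_weight_def by (subst sum.swap) (simp add: sum_fibres assms)

text \<open>Contraction restricts the available cuts to unions of fibres without changing their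
  values; this carries a minimum found among contracted vertices back to the original graph.\<close>

lemma cut_class_weight:
  assumes "finite V" "finite S" "r ` V \<subseteq> S"
  shows "cut (class_weight r V h) S C = cut h V {v. r v \<in> C}"
proof -
  have "cut (class_weight r V h) S C
      = (\<Sum>x\<in>S \<inter> C. \<Sum>u\<in>{u\<in>V. r u = x}. \<Sum>v\<in>{v\<in>V. r v \<in> S - C}. h u v)"
    unfolding cut_def using assms by (simp add: sum_class_weight)
  also have "\<dots> = (\<Sum>u\<in>{u\<in>V. r u \<in> S \<inter> C}. \<Sum>v\<in>{v\<in>V. r v \<in> S - C}. h u v)"
    using assms by (subst sum_fibres) auto
  also have "{u\<in>V. r u \<in> S \<inter> C} = V \<inter> {v. r v \<in> C}" using assms(3) by auto
  also have "{v\<in>V. r v \<in> S - C} = V - {v. r v \<in> C}" using assms(3) by auto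
  finally show ?thesis by (simp add: cut_def)
qed

section \<open>Colour shifts\<close>

definition cross :: "(nat \<Rightarrow> nat \<Rightarrow> bool) \<Rightarrow> (nat \<Rightarrow> nat) \<Rightarrow> nat \<Rightarrow> nat \<Rightarrow> nat" where
  "cross E c u v = of_bool (E u v \<and> c u \<noteq> c v)"

text \<open>Sums over ordered pairs, so every monochromatic edge counts twice.\<close>

definition mono_count :: "nat \<Rightarrow> (nat \<Rightarrow> nat \<Rightarrow> bool) \<Rightarrow> (nat \<Rightarrow> nat) \<Rightarrow> nat" where
  "mono_count n E c = (\<Sum>u<n. \<Sum>v<n. of_bool (E u v \<and> c u = c v))"

lemma mono_count_cong: "(\<And>u. u < n \<Longrightarrow> c u = d u) \<Longrightarrow> mono_count n E c = mono_count n E d"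
  by (simp add: mono_count_def)

lemma mono_count_le: "mono_count n E c \<le> n * n"
proof -
  have "mono_count n E c \<le> (\<Sum>u<n. \<Sum>v<n. 1)"
    unfolding mono_count_def by (intro sum_mono) simp
  then show ?thesis by simp
qed

definition shift :: "nat \<Rightarrow> nat set \<Rightarrow> nat \<Rightarrow> (nat \<Rightarrow> nat) \<Rightarrow> nat \<Rightarrow> nat" where
  "shift k X l c u = (if u \<in> X then (c u + l) mod k else c u)"

lemma card_shift_eq:
  assumes "a < k" "b < (k::nat)"
  shows "(\<Sum>l<k. of_bool ((a + l) mod k = b) :: nat) = 1"
proof -
  \<comment> \<open>The only solution is \<open>b - a\<close> modulo \<open>k\<close>; adding
    \<open>k\<close> keeps the truncated subtraction exact.\<close>
  have "{l. l < k \<and> (a + l) mod k = b} = {(b + k - a) mod k}"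
  proof (intro equalityI subsetI)
    fix l assume "l \<in> {l. l < k \<and> (a + l) mod k = b}"
    then have l: "l < k" "(a + l) mod k = b" by auto
    show "l \<in> {(b + k - a) mod k}"
    proof (cases "a + l < k")
      case True
      with l assms show ?thesis by auto
    next
      case False
      with l assms have "b = a + l - k" by (simp add: le_mod_geq)
      with l assms False show ?thesis by auto
    qed
  next
    fix l assume "l \<in> {(b + k - a) mod k}"
    then have "l = (b + k - a) mod k" by simp
    then have "(a + l) mod k = (a + (b + k - a)) mod k" by (simp add: mod_add_right_eq)
    also have "\<dots> = b" using assms by simp
    finally show "l \<in> {l. l < k \<and> (a + l) mod k = b}" using \<open>l = _\<close> assms by simp
  qed
  moreover have "(\<Sum>l<k. of_bool ((a + l) mod k = b) :: nat) = card {l. l < k \<and> (a + l) mod k = b}"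
    by (simp add: sum.If_cases of_bool_def Int_def)
  ultimately show ?thesis by simp
qed

lemma sum_shift_eq:
  assumes "c u < k" "c v < k"
  shows "(\<Sum>l<k. of_bool (shift k X l c u = shift k X l c v))
    = (if (u \<in> X) = (v \<in> X) then k * of_bool (c u = c v) else (1::nat))"
proof -
  have inj: "(c u + l) mod k = (c v + l) mod k \<longleftrightarrow> c u = c v" for l
  proof
    assume eq: "(c u + l) mod k = (c v + l) mod k"
    \<comment> \<open>Adding \<open>k - l mod k\<close> undoes the shift by \<open>l\<close> modulo
      \<open>k\<close>.\<close>
    have key: "((x + l) mod k + (k - l mod k)) mod k = x" if "x < k" for x
    proof -
      have "x + l + (k - l mod k) = x + k * (l div k) + k"
        using that mod_less_divisor[of k l] mult_div_mod_eq[of k l] by linarith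
      then have "((x + l) mod k + (k - l mod k)) mod k = (x + k * (l div k) + k) mod k"
        by (simp only: mod_add_left_eq)
      with that show ?thesis by simp
    qed
    have "c u = ((c u + l) mod k + (k - l mod k)) mod k" by (rule key[OF assms(1), symmetric])
    also have "\<dots> = ((c v + l) mod k + (k - l mod k)) mod k" by (simp only: eq)
    also have "\<dots> = c v" by (rule key[OF assms(2)])
    finally show "c u = c v" .
  qed simp
  show ?thesis
    using card_shift_eq[OF assms] card_shift_eq[OF assms(2) assms(1)] assms
    by (auto simp: shift_def inj eq_commute[of "c u" "_ mod _"])
qed

lemma sum_sum_crossing:
  fixes w :: "nat \<Rightarrow> nat \<Rightarrow> nat"
  assumes "\<And>u v. w u v = w v u"
  shows "(\<Sum>u<n. \<Sum>v<n. if (u \<in> X) = (v \<in> X) then 0 else w u v) = 2 * cut w {..<n} X"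
proof -
  have "(\<Sum>u<n. \<Sum>v<n. if (u \<in> X) = (v \<in> X) then 0 else w u v)
     = (\<Sum>u<n. \<Sum>v<n. if u \<in> X then if v \<in> X then 0 else w u v else 0)
       + (\<Sum>u<n. \<Sum>v<n. if v \<in> X then if u \<in> X then 0 else w u v else 0)"
    unfolding sum.distrib[symmetric] by (intro sum.cong refl) auto
  also have "(\<Sum>u<n. \<Sum>v<n. if v \<in> X then if u \<in> X then 0 else w u v else 0)
     = (\<Sum>u<n. \<Sum>v<n. if u \<in> X then if v \<in> X then 0 else w u v else 0)"
    by (subst sum.swap) (intro sum.cong refl if_cong assms)
  also have "(\<Sum>u<n. \<Sum>v<n. if u \<in> X then if v \<in> X then 0 else w u v else 0) = cut w {..<n} X"
  proof -
    have "(\<Sum>u<n. \<Sum>v<n. if u \<in> X then if v \<in> X then 0 else w u v else 0)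
       = (\<Sum>u<n. if u \<in> X then \<Sum>v<n. if v \<in> X then 0 else w u v else 0)"
      by (intro sum.cong refl) auto
    also have "\<dots> = cut w {..<n} X"
      by (simp add: cut_def sum.If_cases Diff_eq flip: Collect_neg_eq)
    finally show ?thesis .
  qed
  finally show ?thesis by simp
qed

text \<open>Average over all \<open>k\<close> shifts. An edge inside or outside \<open>X\<close>
  keeps its status under every shift and a crossing edge is monochromatic once, so optimality bounds
  \<open>k\<close> times the count by \<open>k * same\<close> plus twice the cut of
  \<open>g\<close>. Removing \<open>k * same\<close> shows that monochromatic edges make up at most
  a \<open>k\<close>-th of that cut.\<close>

lemma cut_ge_of_shift_optimal:
  fixes E :: "nat \<Rightarrow> nat \<Rightarrow> bool"
  assumes sym: "\<And>u v. E u v = E v u" and c: "\<And>u. u < n \<Longrightarrow> c u < k"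
    and opt: "\<And>l. l < k \<Longrightarrow> mono_count n E c \<le> mono_count n E (shift k X l c)"
  shows "(k - 1) * cut (\<lambda>u v. of_bool (E u v)) {..<n} X
    \<le> k * cut (cross E c) {..<n} X"
proof -
  define g where "g u v = (of_bool (E u v) :: nat)" for u v
  define b where "b u v = (of_bool (E u v \<and> c u = c v) :: nat)" for u v
  define same where "same = (\<Sum>u<n. \<Sum>v<n. if (u \<in> X) = (v \<in> X) then b u v else 0)"
  have symg: "g u v = g v u" and symb: "b u v = b v u" for u v
    using sym[of u v] by (auto simp: g_def b_def)
  have "k * mono_count n E c = (\<Sum>l<k. mono_count n E c)" by simp
  also have "\<dots> \<le> (\<Sum>l<k. mono_count n E (shift k X l c))"
    by (intro sum_mono opt) simp
  also have "\<dots> = (\<Sum>u<n. \<Sum>v<n. \<Sum>l<k. g u v * of_bool (shift k X l c u = shift k X l c v))"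
    unfolding mono_count_def g_def of_bool_conj
    by (subst sum.swap, rule sum.cong[OF refl], rule sum.swap)
  also have "\<dots> = (\<Sum>u<n. \<Sum>v<n. g u v * (if (u \<in> X) = (v \<in> X) then k * of_bool (c u = c v) else 1))"
    using c by (intro sum.cong refl) (simp only: sum_distrib_left[symmetric] sum_shift_eq lessThan_iff)
  also have "\<dots> = (\<Sum>u<n. \<Sum>v<n. k * (if (u \<in> X) = (v \<in> X) then b u v else 0)
      + (if (u \<in> X) = (v \<in> X) then 0 else g u v))"
    by (intro sum.cong refl) (auto simp: g_def b_def)
  also have "\<dots> = k * same + 2 * cut g {..<n} X"
    by (simp only: sum.distrib sum_distrib_left[symmetric] same_def sum_sum_crossing[of g, OF symg])
  finally have 1: "k * mono_count n E c \<le> k * same + 2 * cut g {..<n} X" .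
  have "mono_count n E c = (\<Sum>u<n. \<Sum>v<n. (if (u \<in> X) = (v \<in> X) then b u v else 0)
      + (if (u \<in> X) = (v \<in> X) then 0 else b u v))"
    unfolding mono_count_def b_def by (intro sum.cong refl) auto
  also have "\<dots> = same + 2 * cut b {..<n} X"
    by (simp only: sum.distrib same_def sum_sum_crossing[of b, OF symb])
  finally have "k * cut b {..<n} X \<le> cut g {..<n} X"
    using 1 by (simp add: algebra_simps)
  moreover have "cut g {..<n} X = cut (cross E c) {..<n} X + cut b {..<n} X"
    unfolding cut_def sum.distrib[symmetric]
    by (intro sum.cong refl) (auto simp: g_def cross_def b_def)
  ultimately have "k * cut g {..<n} X \<le> k * cut (cross E c) {..<n} X + cut g {..<n} X"
    by (simp add: algebra_simps)
  then show ?thesis by (simp add: g_def[abs_def] diff_mult_distrib)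
qed

section \<open>Bounded loop programs\<close>

text \<open>All loops run over \<open>0..<n\<close>, where \<open>n\<close> is the cell \<open>''n''\<close>, which no program may assign.
  Termination and a polynomial time bound then depend on the syntax only.\<close>

datatype loop_prog =
    LSkip
  | LPut string expr expr
  | LSeq loop_prog loop_prog
  | LIf expr loop_prog loop_prog
  | LFor string loop_prog

text \<open>The counter is set from the list of the fold before each pass, not read back from the
  store. The last update to \<open>n\<close> reproduces the value at which the compiled
  \<open>While\<close> exits, so that both semantics agree on the whole store.\<close>

primrec run :: "loop_prog \<Rightarrow> state \<Rightarrow> state" where
  "run LSkip s = s"
| "run (LPut x i e) s = s(x := (s x)(val i s := val e s))"
| "run (LSeq c d) s = run d (run c s)"
| "run (LIf b c d) s = (if val b s \<noteq> 0 then run c s else run d s)"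
| "run (LFor x c) s =
     (fold (\<lambda>i t. run c (t(x := (t x)(0 := i)))) [0..<s ''n'' 0] s)
       (x := (fold (\<lambda>i t. run c (t(x := (t x)(0 := i)))) [0..<s ''n'' 0] s x)(0 := s ''n'' 0))"

fun compile :: "loop_prog \<Rightarrow> prog" where
  "compile LSkip = Skip"
| "compile (LPut x i e) = Put x i e"
| "compile (LSeq c d) = Seq (compile c) (compile d)"
| "compile (LIf b c d) = If b (compile c) (compile d)"
| "compile (LFor x c) =
     Seq (Put x (Lit 0) (Lit 0))
       (While (Sub (Get ''n'' (Lit 0)) (Get x (Lit 0)))
         (Seq (compile c) (Put x (Lit 0) (Add (Get x (Lit 0)) (Lit 1)))))"

fun assigned :: "loop_prog \<Rightarrow> string set" where
  "assigned LSkip = {}"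
| "assigned (LPut x i e) = {x}"
| "assigned (LSeq c d) = assigned c \<union> assigned d"
| "assigned (LIf b c d) = assigned c \<union> assigned d"
| "assigned (LFor x c) = insert x (assigned c)"

fun well_formed :: "loop_prog \<Rightarrow> bool" where
  "well_formed LSkip = True"
| "well_formed (LPut x i e) = (x \<noteq> ''n'')"
| "well_formed (LSeq c d) = (well_formed c \<and> well_formed d)"
| "well_formed (LIf b c d) = (well_formed c \<and> well_formed d)"
| "well_formed (LFor x c) = (well_formed c \<and> x \<noteq> ''n'' \<and> x \<notin> assigned c)"

text \<open>Each pass of a loop pays 6 for the test and 6 for the increment, which makes
  \<open>12\<close>; the \<open>9\<close> is 3 for the initial assignment and 6 for the failing
  test. The factor \<open>[:0, 1:]\<close> is the variable, that is, the number of passes. Adding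
  both branches of a conditional keeps the bound a polynomial.\<close>

fun cost :: "loop_prog \<Rightarrow> nat poly" where
  "cost LSkip = [:1:]"
| "cost (LPut x i e) = [:1 + ops i + ops e:]"
| "cost (LSeq c d) = cost c + cost d"
| "cost (LIf b c d) = [:1 + ops b:] + cost c + cost d"
| "cost (LFor x c) = [:9:] + [:0, 1:] * ([:12:] + cost c)"

section \<open>Running time of compiled programs and the invariant rule for loops\<close>

lemma run_frame: "x \<notin> assigned p \<Longrightarrow> run p s x = s x"
proof (induction p arbitrary: s)
  case (LFor y c)
  have "fold (\<lambda>i t. run c (t(y := (t y)(0 := i)))) xs s x = s x" for xs s
    using LFor by (induction xs arbitrary: s) auto
  with LFor.prems show ?case by simp
qed auto

lemma well_formed_not_assigned: "well_formed p \<Longrightarrow> ''n'' \<notin> assigned p"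
  by (induction p) auto

lemma exec_compile:
  "well_formed p \<Longrightarrow> \<exists>t. exec (compile p) s t (run p s) \<and> t \<le> poly (cost p) (s ''n'' 0)"
proof (induction p arbitrary: s)
  case LSkip
  show ?case using exec.Skip[of s] by auto
next
  case (LPut x i e)
  have "exec (compile (LPut x i e)) s (1 + ops i + ops e) (run (LPut x i e) s)"
    by (simp only: compile.simps run.simps exec.Put)
  moreover have "1 + ops i + ops e \<le> poly (cost (LPut x i e)) (s ''n'' 0)" by simp
  ultimately show ?case by blast
next
  case (LSeq c d)
  obtain t where t: "exec (compile c) s t (run c s)" "t \<le> poly (cost c) (s ''n'' 0)"
    using LSeq by fastforce
  obtain t' where t': "exec (compile d) (run c s) t' (run d (run c s))"
    "t' \<le> poly (cost d) (run c s ''n'' 0)" using LSeq by fastforce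
  have "run c s ''n'' = s ''n''" using LSeq.prems well_formed_not_assigned run_frame by auto
  then show ?case using exec.Seq[OF t(1) t'(1)] t(2) t'(2) by fastforce
next
  case (LIf b c d)
  show ?case
  proof (cases "val b s = 0")
    case True
    obtain t where t: "exec (compile d) s t (run d s)" "t \<le> poly (cost d) (s ''n'' 0)"
      using LIf by fastforce
    then show ?thesis using exec.IfFalse[OF True t(1), of "compile c"] True
      by (intro exI[of _ "1 + ops b + t"]) auto
  next
    case False
    obtain t where t: "exec (compile c) s t (run c s)" "t \<le> poly (cost c) (s ''n'' 0)"
      using LIf by fastforce
    then show ?thesis using exec.IfTrue[OF False t(1), of "compile d"] False
      by (intro exI[of _ "1 + ops b + t"]) auto
  qed
next
  case (LFor x c)
  define n where "n = s ''n'' 0"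
  define B where "B = poly (cost c) n"
  define w where "w = While (Sub (Get ''n'' (Lit 0)) (Get x (Lit 0)))
         (Seq (compile c) (Put x (Lit 0) (Add (Get x (Lit 0)) (Lit 1))))"
  let ?f = "\<lambda>i t. run c (t(x := (t x)(0 := i)))"
  have x: "x \<notin> assigned c" "x \<noteq> ''n''" "''n'' \<notin> assigned c" and wf: "well_formed c"
    using LFor.prems well_formed_not_assigned by auto
  \<comment> \<open>Downward induction on the counter, with the state generalised because each pass
    changes it; \<open>6\<close> is the cost of the failing test.\<close>
  have loop: "\<exists>t. exec w (s(x := (s x)(0 := i))) t
        ((fold ?f [i..<n] s)(x := (fold ?f [i..<n] s x)(0 := n))) \<and> t \<le> 6 + (n - i) * (12 + B)"
    if "i \<le> n" "s ''n'' 0 = n" for i s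
    using that
  proof (induction i arbitrary: s rule: inc_induct)
    case base
    have "exec w (s(x := (s x)(0 := n))) 6 (s(x := (s x)(0 := n)))"
      using exec.WhileFalse[of "Sub (Get ''n'' (Lit 0)) (Get x (Lit 0))" "s(x := (s x)(0 := n))"] x base
      by (simp add: w_def numeral_eq_Suc)
    then have "exec w (s(x := (s x)(0 := n))) 6
        ((fold ?f [n..<n] s)(x := (fold ?f [n..<n] s x)(0 := n)))" by simp
    moreover have "6 \<le> 6 + (n - n) * (12 + B)" by simp
    ultimately show ?case by blast
  next
    case (step i)
    define s1 where "s1 = s(x := (s x)(0 := i))"
    define s2 where "s2 = run c s1"
    have s1: "s1 ''n'' 0 = n" "s1 x 0 = i" using x step by (auto simp: s1_def)
    then have s2: "s2 ''n'' 0 = n" "s2 x 0 = i" using x by (auto simp: s2_def run_frame)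
    obtain t where t: "exec (compile c) s1 t s2" "t \<le> B"
      using LFor.IH[OF wf, of s1] s1 by (auto simp: s2_def B_def)
    obtain t' where t': "exec w (s2(x := (s2 x)(0 := Suc i))) t'
        ((fold ?f [Suc i..<n] s2)(x := (fold ?f [Suc i..<n] s2 x)(0 := n)))"
      "t' \<le> 6 + (n - Suc i) * (12 + B)" using step.IH[of s2] s2(1) by blast
    have "exec (Put x (Lit 0) (Add (Get x (Lit 0)) (Lit 1))) s2 6 (s2(x := (s2 x)(0 := Suc i)))"
      using exec.Put[of x "Lit 0" "Add (Get x (Lit 0)) (Lit 1)" s2] s2 by (simp add: numeral_eq_Suc)
    from exec.WhileTrue[OF _ exec.Seq[OF t(1) this] t'(1)[unfolded w_def]]
    have "exec w s1 (6 + (t + 6) + t')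
        ((fold ?f [Suc i..<n] s2)(x := (fold ?f [Suc i..<n] s2 x)(0 := n)))"
      using s1 step.hyps by (simp add: w_def)
    moreover have "[i..<n] = i # [Suc i..<n]" using step.hyps by (simp add: upt_conv_Cons)
    moreover have "n - i = Suc (n - Suc i)" using step.hyps by simp
    ultimately have "exec w (s(x := (s x)(0 := i))) (6 + (t + 6) + t')
        ((fold ?f [i..<n] s)(x := (fold ?f [i..<n] s x)(0 := n)))"
      and "6 + (t + 6) + t' \<le> 6 + (n - i) * (12 + B)"
      using t t' by (simp_all add: s1_def s2_def)
    then show ?case by blast
  qed
  have run: "run (LFor x c) s = (fold ?f [0..<n] s)(x := (fold ?f [0..<n] s x)(0 := n))"
    by (simp only: run.simps n_def)
  obtain t where t: "exec w (s(x := (s x)(0 := 0))) t (run (LFor x c) s)" "t \<le> 6 + n * (12 + B)"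
    using loop[of 0 s, OF le0 n_def[symmetric]] unfolding run diff_zero by blast
  have "exec (Put x (Lit 0) (Lit 0)) s 3 (s(x := (s x)(0 := 0)))"
    using exec.Put[of x "Lit 0" "Lit 0" s] by (simp add: numeral_eq_Suc)
  from exec.Seq[OF this t(1)] have "exec (compile (LFor x c)) s (3 + t) (run (LFor x c) s)"
    by (simp add: w_def)
  moreover have "3 + t \<le> poly (cost (LFor x c)) (s ''n'' 0)"
    using t(2) by (simp add: n_def B_def)
  ultimately show ?case by blast
qed

text \<open>The frame premise in \<open>step\<close> lets an invariant refer to values at loop
  entry; \<open>counter\<close> absorbs the writes to \<open>x\<close> before each pass and at the
  end.\<close>

lemma run_For_invariant:
  assumes n: "s ''n'' 0 = n" and wf: "well_formed (LFor x c)"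
    and init: "I 0 s"
    and step: "\<And>i t. i < n \<Longrightarrow> I i t \<Longrightarrow> t x 0 = i \<Longrightarrow> t ''n'' 0 = n \<Longrightarrow>
      (\<And>y. y \<notin> assigned (LFor x c) \<Longrightarrow> t y = s y) \<Longrightarrow> I (Suc i) (run c t)"
    and counter: "\<And>i t v. I i t \<Longrightarrow> I i (t(x := (t x)(0 := v)))"
  shows "I n (run (LFor x c) s)"
proof -
  let ?f = "\<lambda>i t. run c (t(x := (t x)(0 := i)))"
  have "I i (fold ?f [0..<i] s) \<and> (\<forall>y. y \<notin> assigned (LFor x c) \<longrightarrow> fold ?f [0..<i] s y = s y)"
    if "i \<le> n" for i
    using that
  proof (induction i)
    case 0
    show ?case using init by simp
  next
    case (Suc i)
    define t where "t = fold ?f [0..<i] s"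
    have "I i t \<and> (\<forall>y. y \<notin> assigned (LFor x c) \<longrightarrow> t y = s y)"
      unfolding t_def by (rule Suc.IH) (use Suc.prems in simp)
    then have IH: "I i t" "\<And>y. y \<notin> assigned (LFor x c) \<Longrightarrow> t y = s y" by blast+
    have "''n'' \<notin> assigned (LFor x c)" using wf by (rule well_formed_not_assigned)
    with IH n wf have tn: "t ''n'' 0 = n" by simp
    have "I (Suc i) (run c (t(x := (t x)(0 := i))))"
      using Suc.prems IH tn wf by (intro step counter) auto
    moreover have "run c (t(x := (t x)(0 := i))) y = s y" if "y \<notin> assigned (LFor x c)" for y
      using that IH(2)[OF that] by (auto simp: run_frame)
    moreover have "fold ?f [0..<Suc i] s = run c (t(x := (t x)(0 := i)))" by (simp add: t_def)
    ultimately show ?case by metis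
  qed
  from this[of n] show ?thesis using counter n by simp
qed

declare run.simps(5) [simp del]

section \<open>The program\<close>

text \<open>The array \<open>c\<close> holds the colouring, and \<open>R\<close> the row offsets \<open>u * n\<close>, as there is no multiplication.
  Contraction is represented by the array \<open>r\<close>, which maps each vertex to the representative of its
  class; \<open>A\<close> is the characteristic function of the current prefix of the adjacency order, with last
  element \<open>t\<close> and last but one \<open>s\<close>. In \<open>select\<close>, \<open>m\<close> is one more than the largest key found, so that
  \<open>0\<close> means that no vertex is left. The flag \<open>stop\<close> survives a round only if no shift succeeded.\<close>

abbreviation Var :: "string \<Rightarrow> expr" where "Var x \<equiv> Get x (Lit 0)"
abbreviation assign :: "string \<Rightarrow> expr \<Rightarrow> loop_prog" where "assign x e \<equiv> LPut x (Lit 0) e"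

text \<open>With truncated subtraction, the sum of the two differences is the distance of the
  values, which \<open>1\<close> minus it turns into a truth value.\<close>

definition eq_expr :: "expr \<Rightarrow> expr \<Rightarrow> expr" where
  "eq_expr a b = Sub (Lit 1) (Add (Sub a b) (Sub b a))"

definition and_expr :: "expr \<Rightarrow> expr \<Rightarrow> expr" where
  "and_expr a b = Sub (Add a b) (Lit 1)"

definition not_expr :: "expr \<Rightarrow> expr" where
  "not_expr a = Sub (Lit 1) a"

lemma val_eq_expr [simp]: "val (eq_expr a b) s = of_bool (val a s = val b s)"
  by (auto simp: eq_expr_def)

lemma val_and_expr:
  "val a s = of_bool P \<Longrightarrow> val b s = of_bool Q \<Longrightarrow> val (and_expr a b) s = of_bool (P \<and> Q)"
  by (simp add: and_expr_def)

lemma val_not_expr [simp]: "val (not_expr a) s = of_bool (val a s = 0)"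
  by (simp add: not_expr_def)

definition double_sum :: "string \<Rightarrow> expr \<Rightarrow> loop_prog" where
  "double_sum acc e = LSeq (assign acc (Lit 0))
     (LFor ''u'' (LFor ''v'' (assign acc (Add (Var acc) e))))"

lemma assigned_double_sum [simp]: "assigned (double_sum acc e) = {acc, ''u'', ''v''}"
  by (auto simp: double_sum_def)

lemma well_formed_double_sum [simp]:
  "well_formed (double_sum acc e) \<longleftrightarrow> acc \<notin> {''n'', ''u'', ''v''}"
  by (auto simp: double_sum_def)

lemma run_double_sum:
  assumes n: "s ''n'' 0 = n" and acc: "acc \<notin> {''n'', ''u'', ''v''}"
    and e: "\<And>t i j. i < n \<Longrightarrow> j < n \<Longrightarrow> (\<And>y. y \<notin> {acc, ''u'', ''v''} \<Longrightarrow> t y = s y) \<Longrightarrow>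
      t ''u'' 0 = i \<Longrightarrow> t ''v'' 0 = j \<Longrightarrow> val e t = f i j"
  shows "run (double_sum acc e) s acc 0 = (\<Sum>i<n. \<Sum>j<n. f i j)"
proof -
  let ?body = "assign acc (Add (Var acc) e)"
  define s0 where "s0 = s(acc := (s acc)(0 := 0))"
  define I where "I i t \<longleftrightarrow> t acc 0 = (\<Sum>i<i. \<Sum>j<n. f i j)" for i and t :: state
  have "I n (run (LFor ''u'' (LFor ''v'' ?body)) s0)"
  proof (rule run_For_invariant)
    show "s0 ''n'' 0 = n" "well_formed (LFor ''u'' (LFor ''v'' ?body))" "I 0 s0"
      using n acc by (auto simp: s0_def I_def)
    show "I i (t(''u'' := (t ''u'')(0 := v)))" if "I i t" for i t v
      using that acc by (auto simp: I_def)
    fix i t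
    assume i: "i < n" and I: "I i t" and u: "t ''u'' 0 = i" and tn: "t ''n'' 0 = n"
      and frame: "\<And>y. y \<notin> assigned (LFor ''u'' (LFor ''v'' ?body)) \<Longrightarrow> t y = s0 y"
    define J where "J j t' \<longleftrightarrow> t' acc 0 = (\<Sum>i<i. \<Sum>j<n. f i j) + (\<Sum>j<j. f i j)"
      for j and t' :: state
    have "J n (run (LFor ''v'' ?body) t)"
    proof (rule run_For_invariant)
      show "t ''n'' 0 = n" "well_formed (LFor ''v'' ?body)" "J 0 t"
        using tn acc I by (auto simp: I_def J_def)
      show "J j (t'(''v'' := (t' ''v'')(0 := v)))" if "J j t'" for j t' v
        using that acc by (auto simp: J_def)
      fix j t'
      assume j: "j < n" and J: "J j t'" and v: "t' ''v'' 0 = j"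
        and frame': "\<And>y. y \<notin> assigned (LFor ''v'' ?body) \<Longrightarrow> t' y = t y"
      have "val e t' = f i j"
      proof (rule e[OF i j])
        show "t' y = s y" if "y \<notin> {acc, ''u'', ''v''}" for y
          using that frame[of y] frame'[of y] by (simp add: s0_def)
        show "t' ''u'' 0 = i" using frame'[of "''u''"] u acc by auto
      qed (rule v)
      then show "J (Suc j) (run ?body t')" using J by (simp add: J_def)
    qed
    then show "I (Suc i) (run (LFor ''v'' ?body) t)" by (simp add: I_def J_def)
  qed
  then show ?thesis by (simp add: double_sum_def s0_def I_def)
qed

definition adj_expr :: expr where
  "adj_expr = Get ''G'' (Add (Get ''R'' (Var ''u'')) (Var ''v''))"

definition same_expr :: "string \<Rightarrow> expr" where
  "same_expr c = eq_expr (Get c (Var ''u'')) (Get c (Var ''v''))"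

text \<open>Its sum over all \<open>u\<close>, \<open>v\<close> is the weight from the class of
  \<open>x\<close> to the prefix \<open>A\<close> in the contracted \<open>H\<close>. Recomputing it
  each time avoids storing contracted weights.\<close>

definition key_expr :: expr where
  "key_expr = and_expr
     (and_expr (eq_expr (Get ''r'' (Var ''u'')) (Var ''x'')) (Get ''A'' (Get ''r'' (Var ''v''))))
     (and_expr adj_expr (not_expr (same_expr ''c'')))"

definition select :: loop_prog where
  "select = LSeq (assign ''m'' (Lit 0))
     (LFor ''x'' (LSeq (double_sum ''a'' key_expr)
       (LIf (eq_expr (Get ''r'' (Var ''x'')) (Var ''x''))
         (LIf (Get ''A'' (Var ''x'')) LSkip
           (LIf (Sub (Add (Var ''a'') (Lit 1)) (Var ''m''))
             (LSeq (assign ''m'' (Add (Var ''a'') (Lit 1))) (assign ''y'' (Var ''x'')))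
             LSkip))
         LSkip)))"

definition extend :: loop_prog where
  "extend = LSeq select
     (LIf (Var ''m'')
       (LSeq (assign ''s'' (Var ''t'')) (LSeq (assign ''t'' (Var ''y'')) (LPut ''A'' (Var ''y'') (Lit 1))))
       LSkip)"

text \<open>Starting \<open>s\<close> and \<open>t\<close> at the representative of vertex
  \<open>0\<close> makes them classes from the outset. With a single class left they stay equal, and
  merging is idle.\<close>

definition adjacency_order :: loop_prog where
  "adjacency_order =
     LSeq (assign ''t'' (Get ''r'' (Lit 0))) (LSeq (assign ''s'' (Var ''t''))
       (LSeq (LFor ''u'' (LPut ''A'' (Var ''u'') (Lit 0))) (LFor ''q'' extend)))"

text \<open>The candidate goes to \<open>D\<close>, since the old colours are still needed for the
  comparison. As colour and shift are below \<open>k\<close>, one conditional subtraction computes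
  the residue.\<close>

definition shift_colours :: loop_prog where
  "shift_colours = LFor ''u''
     (LIf (eq_expr (Get ''r'' (Var ''u'')) (Var ''t''))
       (LSeq (LPut ''D'' (Var ''u'') (Add (Get ''c'' (Var ''u'')) (Var ''l'')))
         (LIf (Sub (Add (Get ''D'' (Var ''u'')) (Lit 1)) (Var ''k''))
           (LPut ''D'' (Var ''u'') (Sub (Get ''D'' (Var ''u'')) (Var ''k''))) LSkip))
       (LPut ''D'' (Var ''u'') (Get ''c'' (Var ''u''))))"

definition try_shift :: loop_prog where
  "try_shift = LSeq shift_colours
     (LSeq (double_sum ''a'' (and_expr adj_expr (same_expr ''D'')))
     (LSeq (double_sum ''b'' (and_expr adj_expr (same_expr ''c'')))
       (LIf (Sub (Var ''b'') (Var ''a''))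
         (LSeq (LFor ''u'' (LPut ''c'' (Var ''u'') (Get ''D'' (Var ''u'')))) (assign ''stop'' (Lit 0)))
         LSkip)))"

text \<open>Loops can only run to \<open>n\<close>; the test cuts the range down to
  \<open>l < k\<close>, and \<open>k \<le> n\<close> ensures that every shift is reached.\<close>

definition try_shifts :: loop_prog where
  "try_shifts = LFor ''l'' (LIf (Sub (Var ''k'') (Var ''l'')) try_shift LSkip)"

definition merge :: loop_prog where
  "merge = LFor ''u'' (LIf (eq_expr (Get ''r'' (Var ''u'')) (Var ''t''))
     (LPut ''r'' (Var ''u'') (Var ''s'')) LSkip)"

definition phase :: loop_prog where
  "phase = LSeq adjacency_order (LSeq try_shifts merge)"

definition improve :: loop_prog where
  "improve = LIf (Var ''stop'') LSkip
     (LSeq (assign ''stop'' (Lit 1))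
       (LSeq (LFor ''u'' (LPut ''r'' (Var ''u'') (Var ''u''))) (LFor ''p'' phase)))"

definition row_offsets :: loop_prog where
  "row_offsets = LFor ''u''
     (LPut ''R'' (Add (Var ''u'') (Lit 1)) (Add (Get ''R'' (Var ''u'')) (Var ''n'')))"

definition write_output :: loop_prog where
  "write_output = LFor ''u'' (LFor ''v''
     (LPut ''H'' (Add (Get ''R'' (Var ''u'')) (Var ''v''))
       (and_expr adj_expr (not_expr (same_expr ''c'')))))"

definition algorithm :: loop_prog where
  "algorithm = LSeq row_offsets (LSeq (LFor ''i'' (LFor ''j'' improve)) write_output)"

section \<open>What the subprograms leave unchanged, and their well-formedness\<close>

lemma assigned_select [simp]: "assigned select = {''a'', ''m'', ''u'', ''v'', ''x'', ''y''}"
  by (auto simp: select_def)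

lemma assigned_extend [simp]:
  "assigned extend = {''a'', ''m'', ''u'', ''v'', ''x'', ''y'', ''s'', ''t'', ''A''}"
  by (auto simp: extend_def)

lemma assigned_adjacency_order [simp]:
  "assigned adjacency_order = {''a'', ''m'', ''u'', ''v'', ''x'', ''y'', ''s'', ''t'', ''A'', ''q''}"
  by (auto simp: adjacency_order_def)

lemma assigned_shift_colours [simp]: "assigned shift_colours = {''u'', ''D''}"
  by (auto simp: shift_colours_def)

lemma assigned_try_shift [simp]:
  "assigned try_shift = {''a'', ''b'', ''u'', ''v'', ''c'', ''D'', ''stop''}"
  by (auto simp: try_shift_def)

lemma assigned_try_shifts [simp]:
  "assigned try_shifts = {''a'', ''b'', ''u'', ''v'', ''c'', ''D'', ''stop'', ''l''}"
  by (auto simp: try_shifts_def)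

lemma assigned_merge [simp]: "assigned merge = {''u'', ''r''}"
  by (auto simp: merge_def)

lemma assigned_phase [simp]:
  "assigned phase = {''a'', ''m'', ''u'', ''v'', ''x'', ''y'', ''s'', ''t'', ''A'', ''q'',
     ''b'', ''c'', ''D'', ''stop'', ''l'', ''r''}"
  by (auto simp: phase_def)

lemma assigned_improve [simp]:
  "assigned improve = {''a'', ''m'', ''u'', ''v'', ''x'', ''y'', ''s'', ''t'', ''A'', ''q'',
     ''b'', ''c'', ''D'', ''stop'', ''l'', ''r'', ''p''}"
  by (auto simp: improve_def)

lemma well_formed_extend [simp]: "well_formed extend"
  by (simp add: extend_def select_def)

lemma well_formed_try_shift [simp]: "well_formed try_shift"
  by (simp add: try_shift_def shift_colours_def)

lemma well_formed_phase [simp]: "well_formed phase"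
  by (simp add: phase_def adjacency_order_def try_shifts_def merge_def)

lemma well_formed_improve [simp]: "well_formed improve"
  by (simp add: improve_def)

lemma well_formed_algorithm: "well_formed algorithm"
  by (simp add: algorithm_def row_offsets_def write_output_def)

section \<open>Correctness\<close>

definition idempotent_below :: "nat \<Rightarrow> (nat \<Rightarrow> nat) \<Rightarrow> bool" where
  "idempotent_below n r \<longleftrightarrow> (\<forall>v<n. r v < n \<and> r (r v) = r v)"

definition classes :: "nat \<Rightarrow> (nat \<Rightarrow> nat) \<Rightarrow> nat set" where
  "classes n r = {x. x < n \<and> r x = x}"

lemma finite_classes [simp]: "finite (classes n r)"
  by (simp add: classes_def)

text \<open>For \<open>t\<close> in \<open>A\<close> the sum is the cut of \<open>{t}\<close> within
  \<open>A\<close>: the last vertex alone is a minimum cut between \<open>s\<close> and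
  \<open>t\<close>.\<close>

definition last_cut_bound :: "('a \<Rightarrow> 'a \<Rightarrow> nat) \<Rightarrow> 'a set \<Rightarrow> 'a \<Rightarrow> 'a \<Rightarrow> bool" where
  "last_cut_bound w A s t \<longleftrightarrow>
     s \<noteq> t \<and> (\<forall>C. (s \<in> C) \<noteq> (t \<in> C) \<longrightarrow> sum (w t) (A - {t}) \<le> cut w A C)"

text \<open>The cut bound is asked for only from two vertices on, because \<open>s\<close> and
  \<open>t\<close> may coincide earlier; the empty prefix merely requires both to lie in
  \<open>S\<close>.\<close>

definition ordered_prefix :: "('a \<Rightarrow> 'a \<Rightarrow> nat) \<Rightarrow> 'a set \<Rightarrow> 'a set \<Rightarrow> 'a \<Rightarrow> 'a \<Rightarrow> bool" where
  "ordered_prefix w S A s t \<longleftrightarrow> A \<subseteq> S \<and> s \<in> S \<and> t \<in> S \<and>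
     (A \<noteq> {} \<longrightarrow> t \<in> A \<and> adjacency_bound w S A t) \<and> (2 \<le> card A \<longrightarrow> last_cut_bound w A s t)"

lemma ordered_prefix_insert:
  assumes "finite S" and sym: "\<And>x y. w x y = w y x" and ord: "ordered_prefix w S A s t"
    and x: "x \<in> S - A" and max: "\<And>u. u \<in> S - A \<Longrightarrow> sum (w u) A \<le> sum (w x) A"
  shows "ordered_prefix w S (insert x A) t x"
proof -
  have fin: "finite A" using ord assms(1) finite_subset by (auto simp: ordered_prefix_def)
  have "adjacency_bound w S (insert x A) x"
  proof (cases "A = {}")
    case True
    then show ?thesis using adjacency_bound_singleton sym by metis
  next
    case False
    then show ?thesis
      using adjacency_bound_insert[OF fin x sym _ max] ord by (auto simp: ordered_prefix_def)
  qed
  moreover have "last_cut_bound w (insert x A) t x" if "2 \<le> card (insert x A)"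
  proof -
    have "A \<noteq> {}" using that by auto
    then have "t \<in> A" "adjacency_bound w S A t" using ord by (auto simp: ordered_prefix_def)
    \<comment> \<open>Apply the invariant of \<open>A\<close> to the vertex \<open>x\<close>: now
      \<open>t\<close> and \<open>x\<close> are the last two vertices, and
      \<open>insert x A - {x}\<close> is \<open>A\<close>.\<close>
    then show ?thesis using x by (auto simp: last_cut_bound_def adjacency_bound_def)
  qed
  ultimately show ?thesis using ord x by (auto simp: ordered_prefix_def)
qed

text \<open>\<open>L\<close> is to be the edge-connectivity, entering only through this lower bound.
  Separation is expressed by two witnesses below \<open>n\<close>, so \<open>X\<close> may contain
  other numbers.\<close>

locale graph_input =
  fixes n k L :: nat and E :: "nat \<Rightarrow> nat \<Rightarrow> bool"
  assumes E_commute: "\<And>u v. E u v = E v u" and n_pos: "0 < n" and k_pos: "0 < k" and k_le: "k \<le> n"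
    and L: "\<And>X u v. u < n \<Longrightarrow> v < n \<Longrightarrow> u \<in> X \<Longrightarrow> v \<notin> X \<Longrightarrow>
      L \<le> cut (\<lambda>u v. of_bool (E u v)) {..<n} X"
begin

definition env :: "state \<Rightarrow> bool" where
  "env s \<longleftrightarrow> s ''n'' 0 = n \<and> s ''k'' 0 = k \<and> (\<forall>u<n. s ''R'' u = u * n) \<and>
     (\<forall>u<n. \<forall>v<n. s ''G'' (u * n + v) = of_bool (E u v))"

lemma env_cong:
  assumes "env s" "t ''n'' = s ''n''" "t ''k'' = s ''k''" "t ''R'' = s ''R''" "t ''G'' = s ''G''"
  shows "env t"
  using assms by (simp add: env_def)

lemma env_run: "env s \<Longrightarrow> assigned p \<inter> {''n'', ''k'', ''R'', ''G''} = {} \<Longrightarrow> env (run p s)"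
  by (rule env_cong) (auto simp: run_frame)

lemma val_adj_expr: "env s \<Longrightarrow> s ''u'' 0 < n \<Longrightarrow> s ''v'' 0 < n \<Longrightarrow>
    val adj_expr s = of_bool (E (s ''u'' 0) (s ''v'' 0))"
  by (simp add: adj_expr_def env_def)

lemma val_same_expr: "val (same_expr x) s = of_bool (s x (s ''u'' 0) = s x (s ''v'' 0))"
  by (simp add: same_expr_def)

section \<open>Weights of the contracted graph and the maximum adjacency order\<close>

definition weight :: "(nat \<Rightarrow> nat) \<Rightarrow> (nat \<Rightarrow> nat) \<Rightarrow> nat \<Rightarrow> nat \<Rightarrow> nat" where
  "weight c r = class_weight r {..<n} (cross E c)"

lemma weight_commute: "weight c r x y = weight c r y x"
  unfolding weight_def by (rule class_weight_commute) (auto simp: cross_def E_commute)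

text \<open>Brings the weight into the form that \<open>double_sum\<close> accumulates for
  \<open>key_expr\<close>.\<close>

lemma sum_weight:
  assumes "finite A"
  shows "sum (weight c r x) A
    = (\<Sum>u<n. \<Sum>v<n. of_bool ((r u = x \<and> r v \<in> A) \<and> E u v \<and> \<not> c u = c v))"
proof -
  have "sum (weight c r x) A
    = (\<Sum>u<n. if r u = x then \<Sum>v<n. if r v \<in> A then cross E c u v else 0 else 0)"
    unfolding weight_def
    by (simp only: sum_class_weight[OF finite_lessThan assms] sum.inter_filter[OF finite_lessThan])
  also have "\<dots> = (\<Sum>u<n. \<Sum>v<n. of_bool ((r u = x \<and> r v \<in> A) \<and> E u v \<and> \<not> c u = c v))"
  proof (intro sum.cong refl)
    fix u
    show "(if r u = x then \<Sum>v<n. if r v \<in> A then cross E c u v else 0 else 0)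
      = (\<Sum>v<n. of_bool ((r u = x \<and> r v \<in> A) \<and> E u v \<and> \<not> c u = c v))"
    proof (cases "r u = x")
      case True
      show ?thesis unfolding if_P[OF True] by (intro sum.cong refl) (auto simp: cross_def True)
    qed simp
  qed
  finally show ?thesis .
qed

lemma run_mono_count:
  assumes "env s" "acc \<notin> {''n'', ''k'', ''R'', ''G'', ''u'', ''v'', x}" "x \<notin> {''u'', ''v''}"
  shows "run (double_sum acc (and_expr adj_expr (same_expr x))) s acc 0 = mono_count n E (s x)"
  unfolding mono_count_def
proof (rule run_double_sum)
  fix t i j assume *: "i < n" "j < n" "\<And>y. y \<notin> {acc, ''u'', ''v''} \<Longrightarrow> t y = s y"
    "t ''u'' 0 = i" "t ''v'' 0 = j"
  have "env t" using assms(1) by (rule env_cong) (use * assms in auto)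
  moreover have "t x = s x" using * assms by auto
  ultimately show "val (and_expr adj_expr (same_expr x)) t = of_bool (E i j \<and> s x i = s x j)"
    using * by (intro val_and_expr) (simp_all add: val_adj_expr val_same_expr)
qed (use assms in \<open>auto simp: env_def\<close>)

lemma run_key:
  assumes "env s" and r: "idempotent_below n (s ''r'')"
    and A: "\<And>a. a < n \<Longrightarrow> s ''A'' a = of_bool (a \<in> A)" "finite A"
  shows "run (double_sum ''a'' key_expr) s ''a'' 0 = sum (weight (s ''c'') (s ''r'') (s ''x'' 0)) A"
  unfolding sum_weight[OF A(2)]
proof (rule run_double_sum)
  fix t i j assume *: "i < n" "j < n" "\<And>y. y \<notin> {''a'', ''u'', ''v''} \<Longrightarrow> t y = s y"
    "t ''u'' 0 = i" "t ''v'' 0 = j"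
  have "env t" using assms(1) by (rule env_cong) (use * in auto)
  moreover have "t ''c'' = s ''c''" "t ''r'' = s ''r''" "t ''A'' = s ''A''" "t ''x'' = s ''x''"
    using * by auto
  moreover have "s ''r'' j < n" using r * by (auto simp: idempotent_below_def)
  ultimately show "val key_expr t = of_bool ((s ''r'' i = s ''x'' 0 \<and> s ''r'' j \<in> A) \<and>
      E i j \<and> \<not> s ''c'' i = s ''c'' j)"
    unfolding key_expr_def using * A
    by (intro val_and_expr) (simp_all add: val_adj_expr val_same_expr)
qed (use assms in \<open>auto simp: env_def\<close>)

lemma run_select:
  assumes env: "env s" and r: "idempotent_below n (s ''r'')"
    and A: "\<And>a. a < n \<Longrightarrow> s ''A'' a = of_bool (a \<in> A)" "A \<subseteq> classes n (s ''r'')"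
  defines "w \<equiv> weight (s ''c'') (s ''r'')" and "U \<equiv> classes n (s ''r'') - A"
    and "s' \<equiv> run select s"
  shows "if U = {} then s' ''m'' 0 = 0
    else s' ''m'' 0 \<noteq> 0 \<and> s' ''y'' 0 \<in> U \<and> (\<forall>z\<in>U. sum (w z) A \<le> sum (w (s' ''y'' 0)) A)"
proof -
  define s0 where "s0 = s(''m'' := (s ''m'')(0 := 0))"
  have "finite A" using A(2) finite_subset[OF _ finite_classes] by blast
  define I where "I i t \<longleftrightarrow> (if {z\<in>U. z < i} = {} then t ''m'' 0 = 0
    else t ''y'' 0 \<in> U \<and> t ''m'' 0 = Suc (sum (w (t ''y'' 0)) A) \<and>
      (\<forall>z\<in>U. z < i \<longrightarrow> sum (w z) A \<le> sum (w (t ''y'' 0)) A))" for i :: nat and t :: state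
  define body where "body = (LSeq (double_sum ''a'' key_expr)
       (LIf (eq_expr (Get ''r'' (Var ''x'')) (Var ''x''))
         (LIf (Get ''A'' (Var ''x'')) LSkip
           (LIf (Sub (Add (Var ''a'') (Lit 1)) (Var ''m''))
             (LSeq (assign ''m'' (Add (Var ''a'') (Lit 1))) (assign ''y'' (Var ''x'')))
             LSkip))
         LSkip))"
  have "I n (run (LFor ''x'' body) s0)"
  proof (rule run_For_invariant)
    show "s0 ''n'' 0 = n" using env by (simp add: s0_def env_def)
    show "well_formed (LFor ''x'' body)" by (simp add: body_def)
    show "I 0 s0" by (simp add: I_def s0_def)
    show "I i (t(''x'' := (t ''x'')(0 := v)))" if "I i t" for i t v
      using that by (simp add: I_def)
    fix i t assume i: "i < n" and I: "I i t" and x: "t ''x'' 0 = i"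
      and frame: "\<And>y. y \<notin> assigned (LFor ''x'' body) \<Longrightarrow> t y = s0 y"
    have same: "t y = s y" if "y \<in> {''n'', ''k'', ''R'', ''G'', ''r'', ''A'', ''c''}" for y
      using that frame[of y] by (auto simp: body_def s0_def)
    have envt: "env t" using env by (rule env_cong) (simp_all add: same)
    define t1 where "t1 = run (double_sum ''a'' key_expr) t"
    have a: "t1 ''a'' 0 = sum (w i) A"
      unfolding t1_def w_def x[symmetric] same[of "''r''", simplified, symmetric]
        same[of "''c''", simplified, symmetric]
      by (rule run_key) (use envt r A \<open>finite A\<close> same in auto)
    have t1: "t1 y = t y" if "y \<notin> {''a'', ''u'', ''v''}" for y
      using that by (simp add: t1_def run_frame)
    have U: "i \<in> U \<longleftrightarrow> s ''r'' i = i \<and> s ''A'' i = 0" using i A(1)[OF i] by (auto simp: U_def classes_def)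
    have body: "run body t = (if i \<in> U \<and> \<not> Suc (sum (w i) A) \<le> t1 ''m'' 0
        then t1(''m'' := (t1 ''m'')(0 := Suc (sum (w i) A)), ''y'' := (t1 ''y'')(0 := i)) else t1)"
      unfolding body_def by (auto simp: t1_def[symmetric] t1 x same U a)
    have split: "{z \<in> U. z < Suc i} = (if i \<in> U then insert i {z\<in>U. z < i} else {z\<in>U. z < i})"
      by (auto simp: less_Suc_eq)
    have t1my: "t1 ''m'' = t ''m''" "t1 ''y'' = t ''y''" by (simp_all add: t1)
    show "I (Suc i) (run body t)"
    proof (cases "i \<in> U")
      case False
      then have "z < Suc i \<longleftrightarrow> z < i" if "z \<in> U" for z using that less_Suc_eq by metis
      with False I show ?thesis unfolding I_def split body by (simp add: t1my)
    next
      case iU: True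
      show ?thesis
      proof (cases "{z\<in>U. z < i} = {}")
        case True
        then have "\<not> z < i" if "z \<in> U" for z using that by blast
        moreover have "t ''m'' 0 = 0" using I True by (simp add: I_def)
        ultimately show ?thesis using iU unfolding I_def split body by (auto simp: less_Suc_eq t1my)
      next
        case False
        then have y: "t ''y'' 0 \<in> U" "t ''m'' 0 = Suc (sum (w (t ''y'' 0)) A)"
          and max: "\<And>z. z \<in> U \<Longrightarrow> z < i \<Longrightarrow> sum (w z) A \<le> sum (w (t ''y'' 0)) A"
          using I by (auto simp: I_def split: if_splits)
        show ?thesis
        proof (cases "sum (w i) A < sum (w (t ''y'' 0)) A")
          case True
          then have "run body t = t1" using y by (simp add: body t1my)
          then show ?thesis using iU y max True unfolding I_def split
            by (auto simp: less_Suc_eq t1my)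
        next
          case False
          then have le: "sum (w (t ''y'' 0)) A \<le> sum (w i) A" by simp
          have "sum (w z) A \<le> sum (w i) A" if "z \<in> U" "z < Suc i" for z
            using max[of z] that le by (cases "z = i") auto
          \<comment> \<open>The comparison is strict: in a tie the earlier vertex stays, whose key
            is equally large.\<close>
          moreover have "run body t ''y'' 0 = i \<and> run body t ''m'' 0 = Suc (sum (w i) A)
              \<or> sum (w (t ''y'' 0)) A = sum (w i) A \<and>
                run body t ''y'' = t ''y'' \<and> run body t ''m'' = t ''m''"
            using le iU y by (auto simp: body t1my)
          ultimately show ?thesis using iU y unfolding I_def split by (auto simp: t1my)
        qed
      qed
    qed
  qed
  moreover have "run (LFor ''x'' body) s0 = s'"
    unfolding s'_def select_def body_def s0_def by simp
  ultimately have "I n s'" by simp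
  moreover have "{z\<in>U. z < n} = U" by (auto simp: U_def classes_def)
  moreover have "z < n" if "z \<in> U" for z using that by (auto simp: U_def classes_def)
  ultimately show ?thesis by (cases "U = {}") (simp_all add: I_def)
qed

text \<open>The last alternative is the measure of progress: it makes \<open>n\<close> steps exhaust
  the classes, of which there are at most \<open>n\<close>.\<close>

lemma run_extend:
  assumes env: "env s" and r: "idempotent_below n (s ''r'')"
    and A: "\<And>a. a < n \<Longrightarrow> s ''A'' a = of_bool (a \<in> A)"
    and ord: "ordered_prefix (weight (s ''c'') (s ''r'')) (classes n (s ''r'')) A (s ''s'' 0) (s ''t'' 0)"
  obtains B where "\<And>a. a < n \<Longrightarrow> run extend s ''A'' a = of_bool (a \<in> B)"
    "ordered_prefix (weight (s ''c'') (s ''r'')) (classes n (s ''r'')) B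
      (run extend s ''s'' 0) (run extend s ''t'' 0)"
    "B = classes n (s ''r'') \<or> card B = Suc (card A)"
proof -
  define S where "S = classes n (s ''r'')"
  define w where "w = weight (s ''c'') (s ''r'')"
  define s1 where "s1 = run select s"
  have A': "A \<subseteq> S" using ord by (auto simp: ordered_prefix_def S_def)
  then have "finite A" using finite_subset[OF _ finite_classes] by (auto simp: S_def)
  have s1: "s1 ''A'' = s ''A''" "s1 ''s'' = s ''s''" "s1 ''t'' = s ''t''"
    by (simp_all add: s1_def run_frame)
  have sel: "if S - A = {} then s1 ''m'' 0 = 0
    else s1 ''m'' 0 \<noteq> 0 \<and> s1 ''y'' 0 \<in> S - A \<and> (\<forall>z\<in>S - A. sum (w z) A \<le> sum (w (s1 ''y'' 0)) A)"
    unfolding s1_def S_def w_def using run_select[OF env r A] A' by (simp add: S_def)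
  show ?thesis
  proof (cases "S - A = {}")
    case True
    then have "run extend s = s1" using sel by (simp add: extend_def s1_def[symmetric])
    moreover have "A = S" using True A' by auto
    ultimately show ?thesis using that[of A] A ord s1 by (simp add: S_def w_def)
  next
    case False
    define y where "y = s1 ''y'' 0"
    have y: "y \<in> S - A" "\<And>z. z \<in> S - A \<Longrightarrow> sum (w z) A \<le> sum (w y) A"
      and m: "s1 ''m'' 0 \<noteq> 0" using sel False by (auto simp: y_def)
    then have "run extend s ''A'' = (s ''A'')(y := 1)" "run extend s ''s'' 0 = s ''t'' 0"
      "run extend s ''t'' 0 = y"
      using m by (simp_all add: extend_def s1_def[symmetric] s1 y_def)
    moreover have "ordered_prefix w S (insert y A) (s ''t'' 0) y"
      by (rule ordered_prefix_insert) (use ord y in \<open>auto simp: S_def w_def weight_commute\<close>)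
    moreover have "card (insert y A) = Suc (card A)" using y(1) \<open>finite A\<close> by simp
    ultimately show ?thesis using that[of "insert y A"] A by (simp add: S_def w_def)
  qed
qed

lemma run_adjacency_order:
  assumes env: "env s" and r: "idempotent_below n (s ''r'')"
  shows "ordered_prefix (weight (s ''c'') (s ''r'')) (classes n (s ''r'')) (classes n (s ''r''))
    (run adjacency_order s ''s'' 0) (run adjacency_order s ''t'' 0)"
proof -
  define S where "S = classes n (s ''r'')"
  define w where "w = weight (s ''c'') (s ''r'')"
  define s1 where "s1 = s(''t'' := (s ''t'')(0 := s ''r'' 0))"
  define s2 where "s2 = s1(''s'' := (s ''s'')(0 := s ''r'' 0))"
  define s3 where "s3 = run (LFor ''u'' (LPut ''A'' (Var ''u'') (Lit 0))) s2"
  define Z where "Z i t \<longleftrightarrow> (\<forall>a<i. t ''A'' a = 0)" for i and t :: state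
  have "Z n s3"
    unfolding s3_def by (rule run_For_invariant)
      (use env in \<open>auto simp: less_Suc_eq s1_def s2_def env_def Z_def\<close>)
  then have A0: "\<And>a. a < n \<Longrightarrow> s3 ''A'' a = 0" by (simp add: Z_def)
  have s3: "s3 y = s y" if "y \<notin> {''t'', ''s'', ''u'', ''A''}" for y
    using that by (simp add: s3_def s2_def s1_def run_frame)
  have st: "s3 ''t'' 0 = s ''r'' 0" "s3 ''s'' 0 = s ''r'' 0"
    by (simp_all add: s3_def s2_def s1_def run_frame)
  have r0: "s ''r'' 0 \<in> S" using r n_pos by (auto simp: S_def classes_def idempotent_below_def)
  have "card S \<le> card {..<n}" by (rule card_mono) (auto simp: S_def classes_def)
  then have cardS: "card S \<le> n" by simp
  define I where "I i t \<longleftrightarrow> (\<exists>A. (\<forall>a<n. t ''A'' a = of_bool (a \<in> A)) \<and>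
     ordered_prefix w S A (t ''s'' 0) (t ''t'' 0) \<and> (A = S \<or> i \<le> card A))" for i and t :: state
  have "I n (run (LFor ''q'' extend) s3)"
  proof (rule run_For_invariant)
    show "s3 ''n'' 0 = n" using env by (simp add: s3 env_def)
    show "I 0 s3" unfolding I_def
      using A0 r0 by (intro exI[of _ "{}"]) (simp add: ordered_prefix_def st)
    show "I i (t(''q'' := (t ''q'')(0 := v)))" if "I i t" for i t v
      using that by (simp add: I_def)
    fix i t assume I: "I i t" and frame: "\<And>y. y \<notin> assigned (LFor ''q'' extend) \<Longrightarrow> t y = s3 y"
    have same: "t y = s y" if "y \<in> {''n'', ''k'', ''R'', ''G'', ''r'', ''c''}" for y
      using that frame[of y] s3[of y] by auto
    have "env t" using env by (rule env_cong) (simp_all add: same)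
    moreover obtain A where A: "\<And>a. a < n \<Longrightarrow> t ''A'' a = of_bool (a \<in> A)"
      "ordered_prefix w S A (t ''s'' 0) (t ''t'' 0)" "A = S \<or> i \<le> card A"
      using I by (auto simp: I_def)
    ultimately obtain B where B: "\<And>a. a < n \<Longrightarrow> run extend t ''A'' a = of_bool (a \<in> B)"
      "ordered_prefix w S B (run extend t ''s'' 0) (run extend t ''t'' 0)"
      "B = S \<or> card B = Suc (card A)"
      using run_extend[of t A] r by (auto simp: same S_def w_def)
    have "B = S \<or> Suc i \<le> card B"
    proof (cases "A = S")
      case True
      then have "B = S"
        using B(2,3) card_mono[of S B] by (auto simp: ordered_prefix_def S_def)
      then show ?thesis by simp
    next
      case False
      then show ?thesis using A(3) B(3) by auto
    qed
    with B show "I (Suc i) (run extend t)" by (auto simp: I_def)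
  qed simp
  moreover have "run (LFor ''q'' extend) s3 = run adjacency_order s"
    by (simp add: adjacency_order_def s3_def s2_def s1_def)
  ultimately obtain A where "ordered_prefix w S A (run adjacency_order s ''s'' 0) (run adjacency_order s ''t'' 0)"
    "A = S \<or> n \<le> card A" by (auto simp: I_def)
  moreover from this have "A = S"
    using cardS card_subset_eq[of S A] card_mono[of S A]
    by (auto simp: ordered_prefix_def S_def)
  ultimately show ?thesis by (simp add: S_def w_def)
qed

section \<open>Testing the shifts\<close>

definition coloured :: "(nat \<Rightarrow> nat) \<Rightarrow> bool" where
  "coloured c \<longleftrightarrow> (\<forall>u<n. c u < k)"

lemma run_shift_colours:
  assumes env: "env s" and c: "coloured (s ''c'')" and l: "s ''l'' 0 < k" and u: "u < n"
  shows "run shift_colours s ''D'' u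
    = shift k {u. s ''r'' u = s ''t'' 0} (s ''l'' 0) (s ''c'') u"
proof -
  let ?X = "{u. s ''r'' u = s ''t'' 0}"
  define I where "I i t \<longleftrightarrow> (\<forall>u<i. t ''D'' u = shift k ?X (s ''l'' 0) (s ''c'') u)"
    for i and t :: state
  have "I n (run shift_colours s)"
    unfolding shift_colours_def
  proof (rule run_For_invariant)
    show "s ''n'' 0 = n" using env by (simp add: env_def)
    show "I 0 s" by (simp add: I_def)
    show "I i (t(''u'' := (t ''u'')(0 := v)))" if "I i t" for i t v
      using that by (simp add: I_def)
    fix i t
    let ?body = "LIf (eq_expr (Get ''r'' (Var ''u'')) (Var ''t''))
       (LSeq (LPut ''D'' (Var ''u'') (Add (Get ''c'' (Var ''u'')) (Var ''l'')))
         (LIf (Sub (Add (Get ''D'' (Var ''u'')) (Lit 1)) (Var ''k''))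
           (LPut ''D'' (Var ''u'') (Sub (Get ''D'' (Var ''u'')) (Var ''k''))) LSkip))
       (LPut ''D'' (Var ''u'') (Get ''c'' (Var ''u'')))"
    assume i: "i < n" and I: "I i t" and ui: "t ''u'' 0 = i"
      and frame: "\<And>y. y \<notin> assigned (LFor ''u'' ?body) \<Longrightarrow> t y = s y"
    have same: "t y = s y" if "y \<notin> {''u'', ''D''}" for y using that frame[of y] by auto
    have ci: "s ''c'' i < k" using c i by (simp add: coloured_def)
    have k: "s ''k'' 0 = k" using env by (simp add: env_def)
    have "run ?body t ''D'' = (t ''D'')(i := shift k ?X (s ''l'' 0) (s ''c'') i)"
    proof (cases "s ''c'' i + s ''l'' 0 < k")
      case True
      then show ?thesis by (simp add: ui same k shift_def)
    next
      case False
      then have "(s ''c'' i + s ''l'' 0) mod k = s ''c'' i + s ''l'' 0 - k"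
        using ci l by (simp add: le_mod_geq)
      then show ?thesis using False by (simp add: ui same k shift_def)
    qed
    then show "I (Suc i) (run ?body t)" using I by (simp add: I_def less_Suc_eq)
  qed simp
  with u show ?thesis by (simp add: I_def)
qed

lemma run_try_shift:
  assumes env: "env s" and c: "coloured (s ''c'')" and l: "s ''l'' 0 < k"
  defines "s' \<equiv> run try_shift s"
  shows "coloured (s' ''c'')"
    and "s' ''c'' = s ''c'' \<and> s' ''stop'' = s ''stop'' \<and> mono_count n E (s ''c'')
        \<le> mono_count n E (shift k {u. s ''r'' u = s ''t'' 0} (s ''l'' 0) (s ''c'')) \<or>
      s' ''stop'' 0 = 0 \<and> mono_count n E (s' ''c'') < mono_count n E (s ''c'')"
proof -
  define d where "d = shift k {u. s ''r'' u = s ''t'' 0} (s ''l'' 0) (s ''c'')"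
  define s1 where "s1 = run shift_colours s"
  define s2 where "s2 = run (double_sum ''a'' (and_expr adj_expr (same_expr ''D''))) s1"
  define s3 where "s3 = run (double_sum ''b'' (and_expr adj_expr (same_expr ''c''))) s2"
  define s4 where "s4 = run (LFor ''u'' (LPut ''c'' (Var ''u'') (Get ''D'' (Var ''u'')))) s3"
  have env1: "env s1" unfolding s1_def using env by (rule env_run) simp
  have env2: "env s2" unfolding s2_def using env1 by (rule env_run) simp
  have env3: "env s3" unfolding s3_def using env2 by (rule env_run) simp
  have s1: "s1 y = s y" if "y \<notin> {''u'', ''D''}" for y using that by (simp add: s1_def run_frame)
  have s2: "s2 y = s1 y" if "y \<notin> {''a'', ''u'', ''v''}" for y using that by (simp add: s2_def run_frame)
  have s3: "s3 y = s2 y" if "y \<notin> {''b'', ''u'', ''v''}" for y using that by (simp add: s3_def run_frame)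
  have D: "s1 ''D'' u = d u" if "u < n" for u
    unfolding s1_def d_def using env c l that by (rule run_shift_colours)
  have "s2 ''a'' 0 = mono_count n E (s1 ''D'')"
    unfolding s2_def using env1 by (rule run_mono_count) simp_all
  also have "\<dots> = mono_count n E d" using D by (rule mono_count_cong)
  finally have a: "s3 ''a'' 0 = mono_count n E d" by (simp add: s3)
  have "s3 ''b'' 0 = mono_count n E (s2 ''c'')"
    unfolding s3_def using env2 by (rule run_mono_count) simp_all
  then have b: "s3 ''b'' 0 = mono_count n E (s ''c'')" by (simp add: s2 s1)
  define I where "I i t \<longleftrightarrow> (\<forall>u<i. t ''c'' u = s3 ''D'' u)" for i and t :: state
  have "I n s4"
    unfolding s4_def by (rule run_For_invariant)
      (use env3 in \<open>auto simp: env_def I_def less_Suc_eq\<close>)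
  then have s4: "s4 ''c'' u = d u" if "u < n" for u using that D by (simp add: I_def s3 s2)
  have s': "s' = (if mono_count n E d < mono_count n E (s ''c'')
      then s4(''stop'' := (s4 ''stop'')(0 := 0)) else s3)"
    by (simp add: s'_def try_shift_def s1_def[symmetric] s2_def[symmetric] s3_def[symmetric]
        s4_def[symmetric] a b)
  have c3: "s3 ''c'' = s ''c''" "s3 ''stop'' = s ''stop''" by (simp_all add: s3 s2 s1)
  have "d u < k" if "u < n" for u using c that k_pos by (simp add: d_def shift_def coloured_def)
  then show "coloured (s' ''c'')" using c by (simp add: s' coloured_def s4 c3)
  have "mono_count n E (s4 ''c'') = mono_count n E d" using s4 by (rule mono_count_cong)
  then show "s' ''c'' = s ''c'' \<and> s' ''stop'' = s ''stop'' \<and> mono_count n E (s ''c'')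
        \<le> mono_count n E (shift k {u. s ''r'' u = s ''t'' 0} (s ''l'' 0) (s ''c'')) \<or>
      s' ''stop'' 0 = 0 \<and> mono_count n E (s' ''c'') < mono_count n E (s ''c'')"
    by (simp add: s' c3 d_def[symmetric])
qed

text \<open>Chains over the phases of a round: no phase sets \<open>stop\<close> back to
  \<open>1\<close>, and the count never rises.\<close>

definition improved :: "state \<Rightarrow> state \<Rightarrow> bool" where
  "improved s s' \<longleftrightarrow> s' ''stop'' 0 = 0 \<and> mono_count n E (s' ''c'') < mono_count n E (s ''c'')"

lemma run_try_shifts:
  assumes env: "env s" and c: "coloured (s ''c'')"
  defines "s' \<equiv> run try_shifts s"
  shows "coloured (s' ''c'')"
    and "improved s s' \<or> s' ''c'' = s ''c'' \<and> s' ''stop'' = s ''stop'' \<and>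
      (k - 1) * cut (\<lambda>u v. of_bool (E u v)) {..<n} {u. s ''r'' u = s ''t'' 0}
        \<le> k * cut (cross E (s ''c'')) {..<n} {u. s ''r'' u = s ''t'' 0}"
proof -
  let ?X = "{u. s ''r'' u = s ''t'' 0}"
  \<comment> \<open>Until a shift succeeds the colouring is the initial one, so all tests made so
    far refer to the same colours; after a success nothing is kept about individual shifts.\<close>
  define I where "I i t \<longleftrightarrow> coloured (t ''c'') \<and> (improved s t \<or>
      t ''c'' = s ''c'' \<and> t ''stop'' = s ''stop'' \<and>
      (\<forall>l<i. l < k \<longrightarrow> mono_count n E (s ''c'') \<le> mono_count n E (shift k ?X l (s ''c''))))"
    for i and t :: state
  have "I n s'"
    unfolding s'_def try_shifts_def
  proof (rule run_For_invariant)
    show "s ''n'' 0 = n" using env by (simp add: env_def)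
    show "I 0 s" using c by (simp add: I_def)
    show "I i (t(''l'' := (t ''l'')(0 := v)))" if "I i t" for i t v
      using that by (simp add: I_def improved_def)
    fix i t
    let ?body = "LIf (Sub (Var ''k'') (Var ''l'')) try_shift LSkip"
    assume I: "I i t" and l: "t ''l'' 0 = i"
      and frame: "\<And>y. y \<notin> assigned (LFor ''l'' ?body) \<Longrightarrow> t y = s y"
    have same: "t y = s y" if "y \<in> {''n'', ''k'', ''R'', ''G'', ''r'', ''t''}" for y
      using that frame[of y] by auto
    have envt: "env t" using env by (rule env_cong) (simp_all add: same)
    then have k: "t ''k'' 0 = k" by (simp add: env_def)
    show "I (Suc i) (run ?body t)"
    proof (cases "i < k")
      case True
      define t' where "t' = run try_shift t"
      have ct: "coloured (t ''c'')" using I by (simp add: I_def)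
      have "coloured (t' ''c'')" and
        "t' ''c'' = t ''c'' \<and> t' ''stop'' = t ''stop'' \<and> mono_count n E (t ''c'')
          \<le> mono_count n E (shift k ?X i (t ''c'')) \<or>
        t' ''stop'' 0 = 0 \<and> mono_count n E (t' ''c'') < mono_count n E (t ''c'')"
        unfolding t'_def using run_try_shift[OF envt ct] True l same by simp_all
      then have "I (Suc i) t'" using I by (auto simp: I_def improved_def less_Suc_eq)
      moreover have "run ?body t = t'" using True by (simp add: k l t'_def)
      ultimately show ?thesis by simp
    next
      case False
      then have "run ?body t = t" by (simp add: k l)
      then show ?thesis using I False by (auto simp: I_def less_Suc_eq)
    qed
  qed simp
  then have I: "coloured (s' ''c'')" "improved s s' \<or> s' ''c'' = s ''c'' \<and> s' ''stop'' = s ''stop'' \<and>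
      (\<forall>l<k. mono_count n E (s ''c'') \<le> mono_count n E (shift k ?X l (s ''c'')))"
    using k_le by (auto simp: I_def)
  show "coloured (s' ''c'')" by (rule I(1))
  show "improved s s' \<or> s' ''c'' = s ''c'' \<and> s' ''stop'' = s ''stop'' \<and>
      (k - 1) * cut (\<lambda>u v. of_bool (E u v)) {..<n} ?X \<le> k * cut (cross E (s ''c'')) {..<n} ?X"
    using I(2) c cut_ge_of_shift_optimal[of E n "s ''c''" k ?X] E_commute
    by (auto simp: coloured_def)
qed

section \<open>Merging two classes, and the sets that survive it\<close>

lemma run_merge:
  assumes env: "env s" and u: "u < n"
  shows "run merge s ''r'' u = (if s ''r'' u = s ''t'' 0 then s ''s'' 0 else s ''r'' u)"
proof -
  \<comment> \<open>Unvisited entries are included with their old values, since the body compares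
    the current entry with \<open>t\<close>.\<close>
  define I where "I i t \<longleftrightarrow>
    (\<forall>u. t ''r'' u = (if u < i \<and> s ''r'' u = s ''t'' 0 then s ''s'' 0 else s ''r'' u))"
    for i and t :: state
  have "I n (run merge s)"
    unfolding merge_def
  proof (rule run_For_invariant)
    show "s ''n'' 0 = n" using env by (simp add: env_def)
    show "I 0 s" by (simp add: I_def)
    show "I i (t(''u'' := (t ''u'')(0 := v)))" if "I i t" for i t v
      using that by (simp add: I_def)
    fix i t
    let ?body = "LIf (eq_expr (Get ''r'' (Var ''u'')) (Var ''t'')) (LPut ''r'' (Var ''u'') (Var ''s'')) LSkip"
    assume I: "I i t" and ui: "t ''u'' 0 = i"
      and frame: "\<And>y. y \<notin> assigned (LFor ''u'' ?body) \<Longrightarrow> t y = s y"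
    have "t ''s'' = s ''s''" "t ''t'' = s ''t''" using frame by auto
    moreover have "t ''r'' i = s ''r'' i" using I by (simp add: I_def)
    ultimately show "I (Suc i) (run ?body t)" using I by (auto simp: I_def ui less_Suc_eq)
  qed simp
  with u show ?thesis by (simp add: I_def)
qed

text \<open>Below \<open>n\<close>, the set \<open>C\<close> is a union of classes, so it is still
  visible as a cut after contraction.\<close>

definition saturated :: "(nat \<Rightarrow> nat) \<Rightarrow> nat set \<Rightarrow> bool" where
  "saturated r C \<longleftrightarrow> (\<forall>u<n. u \<in> C \<longleftrightarrow> r u \<in> C)"

definition cut_large :: "(nat \<Rightarrow> nat) \<Rightarrow> nat set \<Rightarrow> bool" where
  "cut_large c C \<longleftrightarrow> (k - 1) * L \<le> k * cut (cross E c) {..<n} C"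

lemma cut_weight:
  assumes "idempotent_below n r"
  shows "cut (weight c r) (classes n r) C = cut (cross E c) {..<n} {v. r v \<in> C}"
  unfolding weight_def
  by (rule cut_class_weight) (use assms in \<open>auto simp: classes_def idempotent_below_def\<close>)

text \<open>\<open>C\<close> is a cut of the contracted graph that separates \<open>s\<close> and
  \<open>t\<close>, so it is at least the cut of the class of \<open>t\<close>. By
  \<open>large\<close>, the latter is at least the required fraction of its cut in the full graph,
  which is at least \<open>L\<close>.\<close>

lemma merge_step:
  assumes r: "idempotent_below n r" and ord: "ordered_prefix (weight c r) (classes n r) (classes n r) s t"
    and large: "(k - 1) * cut (\<lambda>u v. of_bool (E u v)) {..<n} {u. r u = t}
      \<le> k * cut (cross E c) {..<n} {u. r u = t}"
    and C: "saturated r C" "(s \<in> C) \<noteq> (t \<in> C)"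
  shows "cut_large c C"
proof -
  let ?S = "classes n r"
  have st: "s \<in> ?S" "t \<in> ?S" "s \<noteq> t" using ord C by (auto simp: ordered_prefix_def)
  then have "card {s, t} \<le> card ?S" by (intro card_mono) auto
  with st have "last_cut_bound (weight c r) ?S s t" using ord by (simp add: ordered_prefix_def)
  then have "cut (weight c r) ?S {t} \<le> cut (weight c r) ?S C"
    using C st by (simp add: last_cut_bound_def cut_singleton)
  also have "\<dots> = cut (cross E c) {..<n} C"
    unfolding cut_weight[OF r] using C(1) by (intro cut_cong) (auto simp: saturated_def)
  finally have "cut (cross E c) {..<n} {u. r u = t} \<le> cut (cross E c) {..<n} C"
    by (simp add: cut_weight[OF r])
  then have "k * cut (cross E c) {..<n} {u. r u = t} \<le> k * cut (cross E c) {..<n} C" by simp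
  moreover have "L \<le> cut (\<lambda>u v. of_bool (E u v)) {..<n} {u. r u = t}"
    using st by (intro L[of t s]) (auto simp: classes_def)
  then have "(k - 1) * L \<le> (k - 1) * cut (\<lambda>u v. of_bool (E u v)) {..<n} {u. r u = t}" by simp
  ultimately show ?thesis unfolding cut_large_def using large by linarith
qed

text \<open>Merging destroys saturation only of sets that separate \<open>s\<close> and
  \<open>t\<close>, and \<open>merge_step\<close> settles these. The \<open>max\<close> covers idle
  phases with a single class.\<close>

lemma run_phase:
  assumes env: "env s" and c: "coloured (s ''c'')" and r: "idempotent_below n (s ''r'')"
  defines "s' \<equiv> run phase s"
  shows "coloured (s' ''c'')" "idempotent_below n (s' ''r'')"
    and "card (classes n (s' ''r'')) \<le> max 1 (card (classes n (s ''r'')) - 1)"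
    and "improved s s' \<or> s' ''c'' = s ''c'' \<and> s' ''stop'' = s ''stop'' \<and>
      (\<forall>C. saturated (s ''r'') C \<longrightarrow> saturated (s' ''r'') C \<or> cut_large (s ''c'') C)"
proof -
  define s1 where "s1 = run adjacency_order s"
  define s2 where "s2 = run try_shifts s1"
  have s': "s' = run merge s2" by (simp add: s'_def phase_def s1_def s2_def)
  have env1: "env s1" unfolding s1_def using env by (rule env_run) simp
  have env2: "env s2" unfolding s2_def using env1 by (rule env_run) simp
  have s1: "s1 ''r'' = s ''r''" "s1 ''c'' = s ''c''" "s1 ''stop'' = s ''stop''"
    by (simp_all add: s1_def run_frame)
  have s2: "s2 ''r'' = s ''r''" "s2 ''t'' = s1 ''t''" "s2 ''s'' = s1 ''s''"
    by (simp_all add: s2_def run_frame s1)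
  have s'2: "s' ''c'' = s2 ''c''" "s' ''stop'' = s2 ''stop''" by (simp_all add: s' run_frame)
  let ?r = "s ''r''" and ?s = "s1 ''s'' 0" and ?t = "s1 ''t'' 0"
  have ord: "ordered_prefix (weight (s ''c'') ?r) (classes n ?r) (classes n ?r) ?s ?t"
    unfolding s1_def using env r by (rule run_adjacency_order)
  then have st: "?s \<in> classes n ?r" "?t \<in> classes n ?r" by (auto simp: ordered_prefix_def)
  have r': "s' ''r'' u = (if ?r u = ?t then ?s else ?r u)" if "u < n" for u
    unfolding s' using run_merge[OF env2 that] by (simp add: s2)
  show "idempotent_below n (s' ''r'')"
    unfolding idempotent_below_def
  proof (intro allI impI)
    fix v assume v: "v < n"
    then have "?r v < n" "?r (?r v) = ?r v" "?s < n" "?r ?s = ?s"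
      using r st by (auto simp: idempotent_below_def classes_def)
    then show "s' ''r'' v < n \<and> s' ''r'' (s' ''r'' v) = s' ''r'' v" using v by (simp add: r')
  qed
  have classes': "classes n (s' ''r'') \<subseteq> insert ?s (classes n ?r - {?t})"
    using st by (auto simp: classes_def r' split: if_splits)
  have cardS: "card (classes n ?r - {?t}) = card (classes n ?r) - 1" using st by simp
  show "card (classes n (s' ''r'')) \<le> max 1 (card (classes n ?r) - 1)"
  proof (cases "?s = ?t")
    case True
    \<comment> \<open>With two classes the order would have ended in distinct \<open>s\<close> and
      \<open>t\<close>.\<close>
    have "classes n ?r = {?t}"
    proof (rule ccontr)
      assume "classes n ?r \<noteq> {?t}"
      then obtain x where "x \<in> classes n ?r" "x \<noteq> ?t" using st by blast
      then have "card {x, ?t} \<le> card (classes n ?r)" using st by (intro card_mono) auto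
      with \<open>x \<noteq> ?t\<close> show False using ord True by (simp add: ordered_prefix_def last_cut_bound_def)
    qed
    then have "classes n (s' ''r'') \<subseteq> {?t}" using classes' True by auto
    from card_mono[OF _ this] show ?thesis by simp
  next
    case False
    then have "classes n (s' ''r'') \<subseteq> classes n ?r - {?t}" using classes' st by auto
    from card_mono[OF _ this] show ?thesis using cardS by simp
  qed
  have c1: "coloured (s1 ''c'')" using c by (simp add: s1)
  show "coloured (s' ''c'')"
    unfolding s'2 s2_def using env1 c1 by (rule run_try_shifts)
  have "improved s1 s2 \<or> s2 ''c'' = s1 ''c'' \<and> s2 ''stop'' = s1 ''stop'' \<and>
      (k - 1) * cut (\<lambda>u v. of_bool (E u v)) {..<n} {u. s1 ''r'' u = ?t}
        \<le> k * cut (cross E (s1 ''c'')) {..<n} {u. s1 ''r'' u = ?t}"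
    unfolding s2_def using env1 c1 by (rule run_try_shifts)
  moreover have "saturated (s' ''r'') C \<or> cut_large (s ''c'') C"
    if "(k - 1) * cut (\<lambda>u v. of_bool (E u v)) {..<n} {u. ?r u = ?t}
        \<le> k * cut (cross E (s ''c'')) {..<n} {u. ?r u = ?t}" "saturated ?r C" for C
  proof (cases "(?s \<in> C) = (?t \<in> C)")
    case True
    have "saturated (s' ''r'') C"
      unfolding saturated_def
    proof (intro allI impI)
      fix u assume "u < n"
      then show "(u \<in> C) = (s' ''r'' u \<in> C)" using that(2) True by (auto simp: saturated_def r')
    qed
    then show ?thesis ..
  next
    case False
    with merge_step[OF r ord that] show ?thesis by simp
  qed
  ultimately show "improved s s' \<or> s' ''c'' = s ''c'' \<and> s' ''stop'' = s ''stop'' \<and>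
      (\<forall>C. saturated ?r C \<longrightarrow> saturated (s' ''r'') C \<or> cut_large (s ''c'') C)"
    by (auto simp: improved_def s1 s'2)
qed

section \<open>From single rounds to the whole run\<close>

definition all_cuts_large :: "(nat \<Rightarrow> nat) \<Rightarrow> bool" where
  "all_cuts_large c \<longleftrightarrow> (\<forall>C u v. u < n \<longrightarrow> v < n \<longrightarrow> u \<in> C \<longrightarrow> v \<notin> C \<longrightarrow> cut_large c C)"

text \<open>If every shift of the round failed, all phases worked on one colouring. A set that
  separates two vertices is saturated at the start, but not when at most one class is left, so it
  was settled in between.\<close>

lemma run_improve:
  assumes env: "env s" and c: "coloured (s ''c'')" and stop: "s ''stop'' 0 = 0"
  defines "s' \<equiv> run improve s"
  shows "coloured (s' ''c'')"
    and "improved s s' \<or> s' ''stop'' 0 = 1 \<and> all_cuts_large (s' ''c'')"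
proof -
  define s1 where "s1 = s(''stop'' := (s ''stop'')(0 := 1))"
  define s2 where "s2 = run (LFor ''u'' (LPut ''r'' (Var ''u'') (Var ''u''))) s1"
  have s': "s' = run (LFor ''p'' phase) s2"
    using stop by (simp add: s'_def improve_def s1_def s2_def)
  have env2: "env s2" unfolding s2_def using env by (intro env_run env_cong[OF env]) (simp_all add: s1_def)
  have s2: "s2 ''c'' = s ''c''" "s2 ''stop'' 0 = 1" by (simp_all add: s2_def s1_def run_frame)
  define R where "R i t \<longleftrightarrow> (\<forall>u<i. t ''r'' u = u)" for i and t :: state
  have "R n s2"
    unfolding s2_def by (rule run_For_invariant)
      (use env in \<open>auto simp: env_def R_def less_Suc_eq s1_def\<close>)
  then have r2: "s2 ''r'' u = u" if "u < n" for u using that by (simp add: R_def)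
  then have "classes n (s2 ''r'') = {..<n}" by (auto simp: classes_def)
  then have card2: "card (classes n (s2 ''r'')) = n" by simp
  \<comment> \<open>Each phase loses a class until one is left, so the bound on \<open>card\<close>
    leaves at most one after \<open>n\<close> phases. The last alternative speaks of the colours of
    \<open>s\<close> throughout, as they have not changed.\<close>
  define I where "I i t \<longleftrightarrow> coloured (t ''c'') \<and> idempotent_below n (t ''r'') \<and>
      (card (classes n (t ''r'')) \<le> 1 \<or> card (classes n (t ''r'')) + i \<le> n) \<and>
      (improved s t \<or> t ''c'' = s ''c'' \<and> t ''stop'' 0 = 1 \<and>
        (\<forall>C. saturated (t ''r'') C \<or> cut_large (s ''c'') C))" for i and t :: state
  have "I n s'"
    unfolding s'
  proof (rule run_For_invariant)
    show "s2 ''n'' 0 = n" using env2 by (simp add: env_def)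
    show "I 0 s2" using c by (simp add: I_def s2 card2 r2 saturated_def idempotent_below_def)
    show "I i (t(''p'' := (t ''p'')(0 := v)))" if "I i t" for i t v
      using that by (simp add: I_def improved_def)
    fix i t
    assume I: "I i t" and frame: "\<And>y. y \<notin> assigned (LFor ''p'' phase) \<Longrightarrow> t y = s2 y"
    have envt: "env t" using env2 by (rule env_cong) (simp_all add: frame)
    have ct: "coloured (t ''c'')" and rt: "idempotent_below n (t ''r'')" using I by (auto simp: I_def)
    define t' where "t' = run phase t"
    have "coloured (t' ''c'')" "idempotent_below n (t' ''r'')"
      and card: "card (classes n (t' ''r'')) \<le> max 1 (card (classes n (t ''r'')) - 1)"
      and alt: "improved t t' \<or> t' ''c'' = t ''c'' \<and> t' ''stop'' = t ''stop'' \<and>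
        (\<forall>C. saturated (t ''r'') C \<longrightarrow> saturated (t' ''r'') C \<or> cut_large (t ''c'') C)"
      unfolding t'_def using envt ct rt by (rule run_phase)+
    moreover have "card (classes n (t' ''r'')) \<le> 1 \<or> card (classes n (t' ''r'')) + Suc i \<le> n"
      using card I by (auto simp: I_def)
    moreover have "improved s t' \<or> t' ''c'' = s ''c'' \<and> t' ''stop'' 0 = 1 \<and>
        (\<forall>C. saturated (t' ''r'') C \<or> cut_large (s ''c'') C)"
    proof (cases "improved s t")
      case True
      then show ?thesis using alt by (auto simp: improved_def)
    next
      case False
      then have t: "t ''c'' = s ''c''" "t ''stop'' 0 = 1"
        "\<And>C. saturated (t ''r'') C \<or> cut_large (s ''c'') C" using I by (auto simp: I_def)
      from alt show ?thesis
      proof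
        assume "improved t t'"
        then show ?thesis using t by (simp add: improved_def)
      next
        assume *: "t' ''c'' = t ''c'' \<and> t' ''stop'' = t ''stop'' \<and>
          (\<forall>C. saturated (t ''r'') C \<longrightarrow> saturated (t' ''r'') C \<or> cut_large (t ''c'') C)"
        then have "saturated (t' ''r'') C \<or> cut_large (s ''c'') C" for C
          using t(1) t(3)[of C] by auto
        with * t show ?thesis by simp
      qed
    qed
    ultimately show "I (Suc i) (run phase t)" by (simp add: I_def t'_def)
  qed simp
  then have fin: "coloured (s' ''c'')" "idempotent_below n (s' ''r'')" "card (classes n (s' ''r'')) \<le> 1"
    and alt: "improved s s' \<or> s' ''c'' = s ''c'' \<and> s' ''stop'' 0 = 1 \<and>
        (\<forall>C. saturated (s' ''r'') C \<or> cut_large (s ''c'') C)" by (auto simp: I_def)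
  show "coloured (s' ''c'')" by (rule fin)
  have "\<not> saturated (s' ''r'') C" if "u < n" "v < n" "u \<in> C" "v \<notin> C" for C u v
  proof
    assume "saturated (s' ''r'') C"
    then have "s' ''r'' u \<noteq> s' ''r'' v" using that unfolding saturated_def by metis
    moreover have "{s' ''r'' u, s' ''r'' v} \<subseteq> classes n (s' ''r'')"
      using fin(2) that by (auto simp: classes_def idempotent_below_def)
    from card_mono[OF finite_classes this] have "card {s' ''r'' u, s' ''r'' v} \<le> 1" using fin(3) by simp
    ultimately show False by simp
  qed
  with alt show "improved s s' \<or> s' ''stop'' 0 = 1 \<and> all_cuts_large (s' ''c'')"
    unfolding all_cuts_large_def by metis
qed

text \<open>Covers a run in which every round improves: the count reaches \<open>0\<close>, and
  \<open>H\<close> then has the cuts of the whole graph.\<close>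

lemma all_cuts_large_of_mono_count_0:
  assumes "mono_count n E c = 0"
  shows "all_cuts_large c"
  unfolding all_cuts_large_def cut_large_def
proof (intro allI impI)
  fix C u v assume *: "u < n" "v < n" "u \<in> C" "v \<notin> C"
  have "cross E c a b = of_bool (E a b)" if "a < n" "b < n" for a b
    using assms that by (simp add: mono_count_def cross_def) blast
  then have "cut (cross E c) {..<n} C = cut (\<lambda>u v. of_bool (E u v)) {..<n} C"
    unfolding cut_def by (intro sum.cong refl) auto
  then show "(k - 1) * L \<le> k * cut (cross E c) {..<n} C"
    using L[OF *] by (simp add: mult_le_mono)
qed

text \<open>\<open>m\<close> counts rounds. Once \<open>stop\<close> survives a round, the following
  ones are skipped and the colouring is final; before that the count, at most \<open>n * n\<close>,
  has dropped in every round.\<close>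

definition progress :: "nat \<Rightarrow> state \<Rightarrow> bool" where
  "progress m s \<longleftrightarrow> coloured (s ''c'') \<and>
     (s ''stop'' 0 \<noteq> 0 \<and> all_cuts_large (s ''c'') \<or>
      s ''stop'' 0 = 0 \<and> mono_count n E (s ''c'') + m \<le> n * n)"

lemma progress_improve:
  assumes env: "env s" and p: "progress m s"
  shows "progress (Suc m) (run improve s)"
proof (cases "s ''stop'' 0 = 0")
  case True
  then show ?thesis
    using run_improve[OF env _ True] p by (auto simp: progress_def improved_def)
next
  case False
  then have "run improve s = s" by (simp add: improve_def)
  with p False show ?thesis by (simp add: progress_def)
qed

lemma run_row_offsets:
  assumes n: "s ''n'' 0 = n" and R: "s ''R'' 0 = 0" and u: "u < n"
  shows "run row_offsets s ''R'' u = u * n"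
proof -
  define I where "I i t \<longleftrightarrow> (\<forall>a\<le>i. t ''R'' a = a * n)" for i and t :: state
  have "I n (run row_offsets s)"
    unfolding row_offsets_def by (rule run_For_invariant)
      (use n R in \<open>auto simp: I_def le_Suc_eq\<close>)
  with u show ?thesis by (simp add: I_def)
qed

lemma run_improve_loops:
  assumes env: "env s" and p: "progress 0 s"
  shows "progress (n * n) (run (LFor ''i'' (LFor ''j'' improve)) s)"
proof -
  let ?I = "\<lambda>i t. progress (i * n) t"
  show ?thesis
  proof (rule run_For_invariant[where I = ?I and n = n])
    show "s ''n'' 0 = n" using env by (simp add: env_def)
    show "progress (0 * n) s" using p by simp
    show "progress (i * n) (t(''i'' := (t ''i'')(0 := v)))" if "progress (i * n) t" for i t v
      using that by (simp add: progress_def)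
    fix i t
    assume I: "progress (i * n) t"
      and frame: "\<And>y. y \<notin> assigned (LFor ''i'' (LFor ''j'' improve)) \<Longrightarrow> t y = s y"
    have envt: "env t" using env by (rule env_cong) (simp_all add: frame)
    have "progress (i * n + n) (run (LFor ''j'' improve) t)"
    proof (rule run_For_invariant[where I = "\<lambda>j t. progress (i * n + j) t" and n = n])
      show "t ''n'' 0 = n" using envt by (simp add: env_def)
      show "progress (i * n + 0) t" using I by simp
      show "progress (i * n + j) (t'(''j'' := (t' ''j'')(0 := v)))" if "progress (i * n + j) t'" for j t' v
        using that by (simp add: progress_def)
      fix j t'
      assume J: "progress (i * n + j) t'"
        and frame': "\<And>y. y \<notin> assigned (LFor ''j'' improve) \<Longrightarrow> t' y = t y"
      have "env t'" using envt by (rule env_cong) (simp_all add: frame')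
      then show "progress (i * n + Suc j) (run improve t')" using progress_improve J by simp
    qed simp
    then show "progress (Suc i * n) (run (LFor ''j'' improve) t)" by (simp add: add.commute)
  qed simp
qed

lemma run_write_output:
  assumes env: "env s" and a: "a < n * n"
  shows "run write_output s ''H'' a
    = of_bool (E (a div n) (a mod n) \<and> s ''c'' (a div n) \<noteq> s ''c'' (a mod n))"
proof -
  let ?entry = "\<lambda>a. of_bool (E (a div n) (a mod n) \<and> s ''c'' (a div n) \<noteq> s ''c'' (a mod n)) :: nat"
  let ?put = "LPut ''H'' (Add (Get ''R'' (Var ''u'')) (Var ''v''))
       (and_expr adj_expr (not_expr (same_expr ''c'')))"
  let ?I = "\<lambda>m (t :: state). \<forall>a<m. t ''H'' a = ?entry a"
  have "?I (n * n) (run write_output s)"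
    unfolding write_output_def
  \<comment> \<open>Cells are written in increasing order: row \<open>i\<close> starts with
    everything below \<open>i * n\<close> correct, and the inner loop extends this cell by
    cell.\<close>
  proof (rule run_For_invariant[where I = "\<lambda>i. ?I (i * n)" and n = n])
    show "s ''n'' 0 = n" using env by (simp add: env_def)
    fix i t
    assume i: "i < n" and I: "?I (i * n) t" and ui: "t ''u'' 0 = i"
      and frame: "\<And>y. y \<notin> assigned (LFor ''u'' (LFor ''v'' ?put)) \<Longrightarrow> t y = s y"
    have envt: "env t" using env by (rule env_cong) (simp_all add: frame)
    have "?I (i * n + n) (run (LFor ''v'' ?put) t)"
    proof (rule run_For_invariant[where I = "\<lambda>j. ?I (i * n + j)" and n = n])
      show "t ''n'' 0 = n" using envt by (simp add: env_def)
      fix j t'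
      assume j: "j < n" and J: "?I (i * n + j) t'" and vj: "t' ''v'' 0 = j"
        and frame': "\<And>y. y \<notin> assigned (LFor ''v'' ?put) \<Longrightarrow> t' y = t y"
      have env': "env t'" using envt by (rule env_cong) (simp_all add: frame')
      have "t' ''c'' = s ''c''" "t' ''u'' 0 = i" using frame frame' ui by simp_all
      moreover have "t' ''R'' i = i * n" using env' i by (simp add: env_def)
      moreover have "val (and_expr adj_expr (not_expr (same_expr ''c''))) t'
          = of_bool (E i j \<and> s ''c'' i \<noteq> s ''c'' j)"
        using calculation env' i j vj
        by (intro val_and_expr) (simp_all add: val_adj_expr val_same_expr)
      ultimately have "run ?put t' ''H'' = (t' ''H'')(i * n + j := ?entry (i * n + j))"
        using vj j by simp
      with J show "?I (i * n + Suc j) (run ?put t')" by (simp add: less_Suc_eq)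
    qed (use I in simp_all)
    then show "?I (Suc i * n) (run (LFor ''v'' ?put) t)" by (simp add: add.commute)
  qed simp_all
  with a show ?thesis by simp
qed

lemma run_algorithm:
  assumes "s ''n'' 0 = n" "s ''k'' 0 = k" "s ''R'' 0 = 0" "s ''stop'' 0 = 0" "\<And>u. s ''c'' u = 0"
    and "\<And>u v. u < n \<Longrightarrow> v < n \<Longrightarrow> s ''G'' (u * n + v) = of_bool (E u v)"
  obtains c where "coloured c" "all_cuts_large c"
    "\<And>a. a < n * n \<Longrightarrow> run algorithm s ''H'' a
      = of_bool (E (a div n) (a mod n) \<and> c (a div n) \<noteq> c (a mod n))"
proof -
  define s1 where "s1 = run row_offsets s"
  define s2 where "s2 = run (LFor ''i'' (LFor ''j'' improve)) s1"
  have s1: "s1 y = s y" if "y \<notin> {''u'', ''R''}" for y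
    using that by (simp add: s1_def run_frame row_offsets_def)
  have env1: "env s1"
    unfolding env_def using assms run_row_offsets[of s] by (simp add: s1) (simp add: s1_def)
  have env2: "env s2" unfolding s2_def using env1 by (rule env_run) simp
  \<comment> \<open>The all-zero array is an admissible colouring because \<open>k\<close> is
    positive.\<close>
  have "progress 0 s1"
    using assms mono_count_le k_pos by (simp add: progress_def s1 coloured_def)
  then have "progress (n * n) s2" unfolding s2_def by (rule run_improve_loops[OF env1])
  \<comment> \<open>After \<open>n * n\<close> rounds either \<open>stop\<close> is set or the count
    is \<open>0\<close>.\<close>
  then have "coloured (s2 ''c'')" "all_cuts_large (s2 ''c'')"
    using all_cuts_large_of_mono_count_0 by (auto simp: progress_def)
  moreover have "run algorithm s = run write_output s2" by (simp add: algorithm_def s1_def s2_def)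
  ultimately show ?thesis using that run_write_output[OF env2] by simp
qed

end

section \<open>Edge-connectivity in terms of weighted cuts\<close>

lemma card_cut_edges:
  assumes G: "is_graph G"
  shows "card (cut_edges G X) = cut (\<lambda>u v. of_bool ({u, v} \<in> edges G)) (verts G) X"
proof -
  let ?V = "verts G"
  let ?P = "{(u, v) \<in> (?V \<inter> X) \<times> (?V - X). {u, v} \<in> edges G}"
  have fin: "finite ?V" using G by (simp add: is_graph_def)
  \<comment> \<open>Orienting a cut edge away from \<open>X\<close> turns it into a unique pair; for
    a two-element \<open>e\<close>, \<open>card (e \<inter> X) = 1\<close> means one end on each
    side.\<close>
  have "bij_betw (\<lambda>(u, v). {u, v}) ?P (cut_edges G X)"
    unfolding bij_betw_def
  proof
    show "inj_on (\<lambda>(u, v). {u, v}) ?P" by (auto simp: inj_on_def doubleton_eq_iff)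
    show "(\<lambda>(u, v). {u, v}) ` ?P = cut_edges G X"
    proof (intro equalityI subsetI)
      fix e assume "e \<in> (\<lambda>(u, v). {u, v}) ` ?P"
      then obtain u v where e: "e = {u, v}" "u \<in> X" "v \<notin> X" "{u, v} \<in> edges G" by auto
      then have "e \<inter> X = {u}" by auto
      with e show "e \<in> cut_edges G X" by (simp add: cut_edges_def)
    next
      fix e assume "e \<in> cut_edges G X"
      then have e: "e \<in> edges G" "card (e \<inter> X) = 1" by (auto simp: cut_edges_def)
      then have "e \<subseteq> ?V" "card e = 2" using G by (auto simp: is_graph_def)
      then obtain a b where ab: "e = {a, b}" "a \<noteq> b" by (auto simp: card_2_iff)
      have "(a \<in> X) \<noteq> (b \<in> X)"
        using e(2) ab by (cases "a \<in> X"; cases "b \<in> X") (simp_all add: Int_insert_left)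
      then obtain u v where uv: "e = {u, v}" "u \<in> X" "v \<notin> X"
        using ab by (metis insert_commute)
      then have "(u, v) \<in> ?P" using e(1) \<open>e \<subseteq> ?V\<close> by simp
      then show "e \<in> (\<lambda>(u, v). {u, v}) ` ?P" using uv(1) by (intro image_eqI[of _ _ "(u, v)"]) simp_all
    qed
  qed
  then have "card (cut_edges G X) = card ?P" by (rule bij_betw_same_card[symmetric])
  also have "?P = ((?V \<inter> X) \<times> (?V - X)) \<inter> {p. {fst p, snd p} \<in> edges G}" by auto
  also have "card \<dots> = (\<Sum>p\<in>(?V \<inter> X) \<times> (?V - X). of_bool ({fst p, snd p} \<in> edges G))"
    using fin by simp
  also have "\<dots> = cut (\<lambda>u v. of_bool ({u, v} \<in> edges G)) ?V X"
    by (simp add: cut_def sum.cartesian_product case_prod_beta)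
  finally show ?thesis .
qed

lemma finite_cut_sizes:
  assumes "is_graph G"
  shows "finite {card (cut_edges G X) | X. X \<noteq> {} \<and> X \<subset> verts G}"
proof (rule finite_subset)
  show "{card (cut_edges G X) | X. X \<noteq> {} \<and> X \<subset> verts G}
    \<subseteq> (\<lambda>X. card (cut_edges G X)) ` Pow (verts G)" by auto
  show "finite ((\<lambda>X. card (cut_edges G X)) ` Pow (verts G))"
    using assms by (simp add: is_graph_def)
qed

lemma edge_connectivity_le:
  assumes "is_graph G" "u \<in> verts G" "v \<in> verts G" "u \<in> X" "v \<notin> X"
  shows "edge_connectivity G \<le> cut (\<lambda>u v. of_bool ({u, v} \<in> edges G)) (verts G) X"
proof -
  have "edge_connectivity G \<le> card (cut_edges G (verts G \<inter> X))"
    unfolding edge_connectivity_def using assms by (intro Min_le finite_cut_sizes) auto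
  also have "\<dots> = cut (\<lambda>u v. of_bool ({u, v} \<in> edges G)) (verts G) X"
    unfolding card_cut_edges[OF assms(1)] by (intro cut_cong) blast
  finally show ?thesis .
qed

lemma edge_connectivity_attained:
  assumes "is_graph G" "2 \<le> card (verts G)"
  obtains X u v where "u \<in> verts G" "v \<in> verts G" "u \<in> X" "v \<notin> X"
    "edge_connectivity G = cut (\<lambda>u v. of_bool ({u, v} \<in> edges G)) (verts G) X"
proof -
  let ?M = "{card (cut_edges G X) | X. X \<noteq> {} \<and> X \<subset> verts G}"
  obtain a where a: "a \<in> verts G" using assms(2) by fastforce
  \<comment> \<open>A singleton is a proper subset because there are two vertices, so the minimum
    ranges over a non-empty set.\<close>
  have "card {a} < card (verts G)" using assms(2) by simp
  then have "{a} \<noteq> verts G" by (metis less_irrefl)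
  with a have "card (cut_edges G {a}) \<in> ?M" by blast
  then have "?M \<noteq> {}" by blast
  with finite_cut_sizes[OF assms(1)] have "edge_connectivity G \<in> ?M"
    unfolding edge_connectivity_def by (rule Min_in)
  then obtain X where X: "X \<noteq> {}" "X \<subset> verts G" "edge_connectivity G = card (cut_edges G X)"
    by blast
  then obtain u v where "u \<in> X" "v \<in> verts G" "v \<notin> X" by blast
  with X show ?thesis using that[of u v X] card_cut_edges[OF assms(1), of X] by auto
qed

text \<open>An integer is at least the ceiling of a real as soon as it is at least that real, so the
  inequality with cleared denominator suffices.\<close>

lemma ceiling_fraction_le:
  assumes "0 < k" "(k - 1) * l \<le> k * m"
  shows "\<lceil>(real k - 1) / real k * real l\<rceil> \<le> int m"
proof -
  have "real ((k - 1) * l) \<le> real (k * m)" using assms(2) by (rule of_nat_mono)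
  then have "(real k - 1) / real k * real l \<le> real m"
    using assms(1) by (simp add: of_nat_diff field_simps)
  then show ?thesis by (simp add: ceiling_le_iff)
qed

theorem corollary3p1:
  "\<exists>(A :: prog) (p :: nat poly).
     \<forall>(n :: nat) (k :: nat) (G :: nat graph).
       is_graph G \<and> verts G = {..<n} \<and> 2 \<le> k \<and> k \<le> card (verts G) \<longrightarrow>
       (\<exists>t s H. exec A (input_state n k G) t s \<and> t \<le> poly p n \<and>
          output_graph n s H \<and> spanning_subgraph H G \<and> k_partite k H \<and>
          \<lceil>(real k - 1) / real k * real (edge_connectivity G)\<rceil> \<le> int (edge_connectivity H))"
proof (intro exI[of _ "compile algorithm"] exI[of _ "cost algorithm"] allI impI, elim conjE)
  fix n k :: nat and G :: "nat graph"
  assume G: "is_graph G" and V: "verts G = {..<n}" and k: "2 \<le> k" "k \<le> card (verts G)"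
  define E where "E u v \<longleftrightarrow> {u, v} \<in> edges G" for u v
  define s where "s = run algorithm (input_state n k G)"
  obtain t where t: "exec (compile algorithm) (input_state n k G) t s"
    "t \<le> poly (cost algorithm) n"
    using exec_compile[OF well_formed_algorithm, of "input_state n k G"]
    by (auto simp: s_def input_state_def)
  interpret graph_input n k "edge_connectivity G" E
  proof
    show "E u v = E v u" for u v by (simp add: E_def insert_commute)
    show "0 < n" "0 < k" "k \<le> n" using k V by auto
    show "edge_connectivity G \<le> cut (\<lambda>u v. of_bool (E u v)) {..<n} X"
      if "u < n" "v < n" "u \<in> X" "v \<notin> X" for X u v
      using edge_connectivity_le[OF G, of u v X] that by (simp add: V E_def)
  qed
  have entry: "adj_matrix n F (u * n + v) = of_bool ({u, v} \<in> edges F)" if "u < n" "v < n" for F u v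
  proof -
    have "Suc u * n \<le> n * n" using that(1) by (intro mult_le_mono1) simp
    then have "u * n + v < n * n" using that(2) by simp
    with that show ?thesis by (simp add: adj_matrix_def)
  qed
  have input: "input_state n k G ''n'' 0 = n" "input_state n k G ''k'' 0 = k" "input_state n k G ''R'' 0 = 0"
    "input_state n k G ''stop'' 0 = 0" "input_state n k G ''c'' u = 0" for u
    by (simp_all add: input_state_def)
  have adj: "input_state n k G ''G'' (u * n + v) = of_bool (E u v)" if "u < n" "v < n" for u v
    using entry[OF that] by (simp add: input_state_def E_def)
  obtain c where c: "coloured c" "all_cuts_large c" and
    out: "\<And>a. a < n * n \<Longrightarrow> s ''H'' a = of_bool (E (a div n) (a mod n) \<and> c (a div n) \<noteq> c (a mod n))"
    unfolding s_def using run_algorithm[of "input_state n k G", OF input adj] by blast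
  \<comment> \<open>The graph whose adjacency matrix the program has written; it consists of
    bichromatic edges, so the colour classes are independent.\<close>
  define H where "H = \<lparr>verts = {..<n}, edges = {e \<in> edges G. \<exists>u v. e = {u, v} \<and> c u \<noteq> c v}\<rparr>"
  have edges_H: "{u, v} \<in> edges H \<longleftrightarrow> E u v \<and> c u \<noteq> c v" for u v
    by (auto simp: H_def E_def doubleton_eq_iff)
  have "is_graph H" using G V by (auto simp: is_graph_def H_def)
  then have sub: "spanning_subgraph H G" using V by (simp add: spanning_subgraph_def subgraph_def H_def)
  have "output_graph n s H"
    unfolding output_graph_def
  proof (intro conjI allI impI)
    show "verts H = {..<n}" by (simp add: H_def)
    fix a assume "a < n * n"
    then show "s ''H'' a = adj_matrix n H a" by (simp add: out adj_matrix_def edges_H)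
  qed
  moreover have "k_partite k H"
    unfolding k_partite_def
  proof (intro exI[of _ "\<lambda>i. {v. v < n \<and> c v = i}"] conjI allI impI)
    show "disjoint_family_on (\<lambda>i. {v. v < n \<and> c v = i}) {..<k}"
      by (auto simp: disjoint_family_on_def)
    show "(\<Union>i<k. {v. v < n \<and> c v = i}) = verts H"
      using c(1) by (auto simp: coloured_def H_def)
    show "independent H {v. v < n \<and> c v = i}" if "i < k" for i
      by (auto simp: independent_def H_def)
  qed
  moreover have "\<lceil>(real k - 1) / real k * real (edge_connectivity G)\<rceil> \<le> int (edge_connectivity H)"
  proof (rule ceiling_fraction_le)
    \<comment> \<open>It remains to apply \<open>all_cuts_large\<close> to one set attaining the
      edge-connectivity of \<open>H\<close>, which exists as there are two vertices.\<close>
    have "2 \<le> card (verts H)" using k V by (simp add: H_def)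
    with \<open>is_graph H\<close> obtain X u v where X: "u \<in> verts H" "v \<in> verts H" "u \<in> X" "v \<notin> X"
      "edge_connectivity H = cut (\<lambda>u v. of_bool ({u, v} \<in> edges H)) (verts H) X"
      by (rule edge_connectivity_attained)
    have "(\<lambda>u v. of_bool ({u, v} \<in> edges H)) = cross E c" by (intro ext) (simp add: edges_H cross_def)
    then have "edge_connectivity H = cut (cross E c) {..<n} X" using X(5) by (simp add: H_def)
    moreover have "cut_large c X"
      using c(2) X(1-4) by (auto simp: all_cuts_large_def H_def)
    ultimately show "(k - 1) * edge_connectivity G \<le> k * edge_connectivity H"
      by (simp only: cut_large_def)
  qed (use k in simp)
  ultimately show "\<exists>t s H. exec (compile algorithm) (input_state n k G) t s \<and> t \<le> poly (cost algorithm) n \<and>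
      output_graph n s H \<and> spanning_subgraph H G \<and> k_partite k H \<and>
      \<lceil>(real k - 1) / real k * real (edge_connectivity G)\<rceil> \<le> int (edge_connectivity H)"
    using t sub by blast
qed

end
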